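(* Let $Z_1,\dots,Z_n,Z_{n+1}=(X_{n+1},Y_{n+1})$ be an exchangeable sequence in $\mathbb{R}^{p+1}$, let $\kappa$ be a kernel and let $\varepsilon>0$. Let $Q_n$ be either the tail-corrected conformal predictive distribution or the quantile-matched predictive distribution with $K$ evenly spaced levels (both defined in the context), with atoms $C_{(1)}<\dots<C_{(M)}$ and jump masses $\Delta_i$. Given a bandwidth $h>0$ that satisfies $\varepsilon$-fidelity at each conformal atom, i.e. $\max_{1\le j\le M}|Q_n^h(C_{(j)})-t_j|\le\varepsilon$ for the midpoint targets $t_j$, one preserves an $\epsilon:=\varepsilon+\max_i\tfrac12\Delta_i$ perturbed validity guarantee for the smoothed CDF, $$\sup_{u\in[0,1]}\left|\mathbb{P}\bigl(Q_n^{h,CPD}(Y_{n+1})\le u\bigr)-u\right|\le\epsilon+\frac{1}{n-m+1},$$ and for evenly spaced quantile matching $$\sup_{u\in[0,1]}\left|\mathbb{P}\bigl(Q_n^{h,QM}(Y_{n+1})\le u\bigr)-u\right|\le\varepsilon+\frac{3}{2K}+\frac{1}{n-m+1}.$$ Here $Q_n^{h,CPD}$ and $Q_n^{h,QM}$ denote the smoothed CDFs obtained from the tail-corrected conformal predictive distribution and from the quantile-matched predictive distribution, respectively.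
   Context: Write $z_i=(x_i,y_i)\in\mathbb{R}^p\times\mathbb{R}$. The first $m<n$ observations form the training set, $z_{m+1},\dots,z_n$ the calibration set, and $N:=n-m$. Smoothing. A kernel $\kappa$ is a symmetric, non-negative, integrable function on $\mathbb{R}$ with integral $1$; its CDF is $\mathbb{K}(t)=\int_{-\infty}^t\kappa(s)\,ds$. For a step CDF with jumps at ordered atoms $C_{(1)}<\dots<C_{(M)}$, right-limit levels $F_i$ at $C_{(i)}$, $F_0$ the left limit at $C_{(1)}$, and jump masses $\Delta_i=F_i-F_{i-1}\ge0$, the smoothed CDF with bandwidth $h$ is $Q_n^h(y)=\sum_{i=1}^M\Delta_i\,\mathbb{K}((y-C_{(i)})/h)$, and the midpoint targets are $t_i=\tfrac12(F_{i-1}+F_i)=F_{i-1}+\tfrac12\Delta_i$. Tail-corrected conformal predictive distribution (CPD). Let $E:(\mathbb{R}^{p+1})^{m+1}\to\mathbb{R}$ be a measurable conformity measure that is monotonic ($E(z_1,\dots,z_m,(x,y))$ is non-decreasing in $y$), balanced (the convex hull of $\{E(z_1,\dots,z_m,(x,y)):y\in\mathbb{R}\}$ is an open interval not depending on $x$) and coercive (the convex hull of $E(z_1,\dots,z_m,\mathbb{R}^{p+1})$ is $\mathbb{R}$). The conformal atoms $C_i$, $i=1,\dots,N$, solve $E(z_1,\dots,z_m,(x_{m+i},y_{m+i}))=E(z_1,\dots,z_m,(x_{n+1},C_i))$ and are assumed almost surely distinct; $C_{(1)}<\dots<C_{(N)}$ are the sorted values. Let $\tau\sim\mathrm{Unif}[0,1]$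 be independent of the data. The tail-corrected measure $\tilde\mu_n$ puts mass $\frac{1+\tau}{N+1}$ at $C_{(1)}$, $\frac1{N+1}$ at $C_{(i)}$ for $2\le i\le N-1$, and $\frac{2-\tau}{N+1}$ at $C_{(N)}$; the tail-corrected CPD is $y\mapsto\tilde\mu_n((-\infty,y))+\tau\tilde\mu_n(\{y\})$. In this case $M=N$, $\Delta_1=\frac{1+\tau}{N+1}$, $\Delta_i=\frac1{N+1}$ for $2\le i\le N-1$, and $\Delta_N=\frac{2-\tau}{N+1}$. Quantile matching (QM). A point predictor $\hat y$ is fitted on $z_1,\dots,z_m$; the conformity scores $y_{m+i}-\hat y(x_{m+i})$, $i=1,\dots,N$, and $y_{n+1}-\hat y(x_{n+1})$ are assumed almost surely distinct. Let $A_{(1)}\le\dots\le A_{(N)}$ be the sorted values of $A_i=\hat y(x_{n+1})+y_{m+i}-\hat y(x_{m+i})$. For a positive integer $K<n-m+1$ put $\alpha_i=i/K$ for $0\le i\le K$, $y^{\alpha_i}=A_{(\lceil(N+1)\alpha_i\rceil)}$ for $1\le i\le K-1$, $y^{\alpha_0}=-\infty$, $y^{\alpha_K}=+\infty$. The quantile-matched predictive distribution is $Q_n(y)=\inf\{\alpha_i:y<y^{\alpha_i}\}$ for $y\ge A_{(1)}$ and $Q_n(y)=0$ for $y<A_{(1)}$. It is a step CDF with $M=K$ atoms $A_{(1)},y^{\alpha_1},\dots,y^{\alpha_{K-1}}$ (playing the role of $C_{(1)}<\dots<C_{(M)}$) and jump masses $\Delta_i=\alpha_i-\alpha_{i-1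}=1/K$.
   Formalization: When the equation for a conformal atom has several solutions, C_i is taken to be chosen as a function of the training data, x_{n+1} and the score alone; for arbitrary distinct solutions the claim fails (E = floor(y), Y in [0,1/2], C_i = 0.9 + i/100). *)

theory Defs
  imports "HOL-Probability.Probability" "HOL-Combinatorics.Permutations"
begin

type_synonym 'p obs = "(real ^ 'p) \<times> real"

definition exchangeable :: "'w measure \<Rightarrow> 'i set \<Rightarrow> ('i \<Rightarrow> 'w \<Rightarrow> 'b::topological_space) \<Rightarrow> bool" where
  "exchangeable M I Z \<longleftrightarrow>
     (\<forall>i\<in>I. Z i \<in> borel_measurable M) \<and>
     (\<forall>\<pi>. \<pi> permutes I \<longrightarrow>
        distr M (\<Pi>\<^sub>M i\<in>I. borel) (\<lambda>w. \<lambda>i\<in>I. Z (\<pi> i) w) =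
        distr M (\<Pi>\<^sub>M i\<in>I. borel) (\<lambda>w. \<lambda>i\<in>I. Z i w))"

(* The library's indep_var needs both variables to have the same value type; this is independence
   of the generated sigma-algebras for variables of different types. *)
definition independent_rv ::
  "'w measure \<Rightarrow> 'a measure \<Rightarrow> ('w \<Rightarrow> 'a) \<Rightarrow> 'b measure \<Rightarrow> ('w \<Rightarrow> 'b) \<Rightarrow> bool" where
  "independent_rv M A X B Y \<longleftrightarrow>
     prob_space.indep_set M (sets (vimage_algebra (space M) X A)) (sets (vimage_algebra (space M) Y B))"

(* i-th smallest of f 1, ..., f N, counted with multiplicity; i ranges over {1..N} *)
definition order_stat :: "nat \<Rightarrow> (nat \<Rightarrow> real) \<Rightarrow> nat \<Rightarrow> real" where
  "order_stat N f i = sort (map f [1..<Suc N]) ! (i - 1)"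

definition kernel :: "(real \<Rightarrow> real) \<Rightarrow> bool" where
  "kernel \<kappa> \<longleftrightarrow> (\<forall>t. \<kappa> (- t) = \<kappa> t) \<and> (\<forall>t. 0 \<le> \<kappa> t) \<and>
     integrable lborel \<kappa> \<and> integral\<^sup>L lborel \<kappa> = 1"

definition kernel_cdf :: "(real \<Rightarrow> real) \<Rightarrow> real \<Rightarrow> real" where
  "kernel_cdf \<kappa> t = (LINT s:{..t}|lborel. \<kappa> s)"

(* In the following, Q is a step function and c 1 < ... < c M are its atoms. Levels are one-sided
   limits, so the value of Q at an atom itself (which the tail-corrected distribution randomizes)
   plays no role. *)
definition step_level :: "(real \<Rightarrow> real) \<Rightarrow> (nat \<Rightarrow> real) \<Rightarrow> nat \<Rightarrow> real" where
  "step_level Q c i = (if i = 0 then Lim (at_left (c 1)) Q else Lim (at_right (c i)) Q)"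

definition jump_mass :: "(real \<Rightarrow> real) \<Rightarrow> (nat \<Rightarrow> real) \<Rightarrow> nat \<Rightarrow> real" where
  "jump_mass Q c i = step_level Q c i - step_level Q c (i - 1)"

definition midpoint_target :: "(real \<Rightarrow> real) \<Rightarrow> (nat \<Rightarrow> real) \<Rightarrow> nat \<Rightarrow> real" where
  "midpoint_target Q c i = (step_level Q c (i - 1) + step_level Q c i) / 2"

definition smoothed_cdf ::
  "(real \<Rightarrow> real) \<Rightarrow> (real \<Rightarrow> real) \<Rightarrow> (nat \<Rightarrow> real) \<Rightarrow> nat \<Rightarrow> real \<Rightarrow> real \<Rightarrow> real" where
  "smoothed_cdf \<kappa> Q c M h y = (\<Sum>i=1..M. jump_mass Q c i * kernel_cdf \<kappa> ((y - c i) / h))"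

definition fidelity ::
  "(real \<Rightarrow> real) \<Rightarrow> (real \<Rightarrow> real) \<Rightarrow> (nat \<Rightarrow> real) \<Rightarrow> nat \<Rightarrow> real \<Rightarrow> real \<Rightarrow> bool" where
  "fidelity \<kappa> Q c M h \<epsilon> \<longleftrightarrow>
     (MAX j\<in>{1..M}. \<bar>smoothed_cdf \<kappa> Q c M h (c j) - midpoint_target Q c j\<bar>) \<le> \<epsilon>"

(* A training sequence z_1, ..., z_m is an element of the product space over {1..m}. *)
definition conformity_measure :: "nat \<Rightarrow> ((nat \<Rightarrow> 'p::finite obs) \<Rightarrow> 'p obs \<Rightarrow> real) \<Rightarrow> bool" where
  "conformity_measure m E \<longleftrightarrow>
     (\<lambda>(z, a). E z a) \<in> borel_measurable ((\<Pi>\<^sub>M i\<in>{1..m}. borel) \<Otimes>\<^sub>M borel) \<and>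
     (\<forall>z \<in> space (\<Pi>\<^sub>M i\<in>{1..m}. borel :: 'p obs measure).
        (\<forall>x. mono (\<lambda>y. E z (x, y))) \<and>
        (\<exists>I. open I \<and> is_interval I \<and> (\<forall>x. convex hull (range (\<lambda>y. E z (x, y))) = I)) \<and>
        convex hull (range (E z)) = UNIV)"

(* In the following, z is a realization of the whole sequence z_1, ..., z_{n+1}. *)
definition training :: "nat \<Rightarrow> (nat \<Rightarrow> 'p obs) \<Rightarrow> nat \<Rightarrow> 'p obs" where
  "training m z = (\<lambda>i\<in>{1..m}. z i)"

definition conf_score :: "nat \<Rightarrow> ((nat \<Rightarrow> 'p obs) \<Rightarrow> 'p obs \<Rightarrow> real) \<Rightarrow> (nat \<Rightarrow> 'p obs) \<Rightarrow> nat \<Rightarrow> real" where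
  "conf_score m E z i = E (training m z) (z (m + i))"

(* The atom C_i solves E(z_1,...,z_m,(x_{n+1},C_i)) = r for r = conf_score m E z i. As E need not
   be strictly increasing, the equation can have several solutions; "sol" selects one, and does
   so as a function of the equation, i.e. of the training data, of x_{n+1} and of r. *)
definition conformal_atom ::
  "nat \<Rightarrow> nat \<Rightarrow> ((nat \<Rightarrow> 'p obs) \<Rightarrow> 'p obs \<Rightarrow> real) \<Rightarrow>
   ((nat \<Rightarrow> 'p obs) \<Rightarrow> real ^ 'p \<Rightarrow> real \<Rightarrow> real) \<Rightarrow> (nat \<Rightarrow> 'p obs) \<Rightarrow> nat \<Rightarrow> real" where
  "conformal_atom m n E sol z i = sol (training m z) (fst (z (n + 1))) (conf_score m E z i)"

definition solves_atom_equations ::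
  "nat \<Rightarrow> nat \<Rightarrow> ((nat \<Rightarrow> 'p obs) \<Rightarrow> 'p obs \<Rightarrow> real) \<Rightarrow>
   ((nat \<Rightarrow> 'p obs) \<Rightarrow> real ^ 'p \<Rightarrow> real \<Rightarrow> real) \<Rightarrow> (nat \<Rightarrow> 'p obs) \<Rightarrow> bool" where
  "solves_atom_equations m n E sol z \<longleftrightarrow>
     (\<forall>i\<in>{1..n - m}. E (training m z) (z (m + i)) =
        E (training m z) (fst (z (n + 1)), conformal_atom m n E sol z i))"

(* Mass 1/(N+1) for each atom, and the masses t/(N+1) and (1-t)/(N+1) of the two tails are moved
   to the extreme atoms. For N \<ge> 2 this is (1+t)/(N+1), 1/(N+1), ..., 1/(N+1), (2-t)/(N+1); for
   N = 1 both corrections fall on the only atom, which then has mass 1. *)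
definition tail_mass :: "nat \<Rightarrow> real \<Rightarrow> nat \<Rightarrow> real" where
  "tail_mass N t i = (1 + (if i = 1 then t else 0) + (if i = N then 1 - t else 0)) / real (N + 1)"

definition tail_measure :: "nat \<Rightarrow> real \<Rightarrow> (nat \<Rightarrow> real) \<Rightarrow> real set \<Rightarrow> real" where
  "tail_measure N t c S = (\<Sum>i=1..N. tail_mass N t i * indicator S (c i))"

definition tail_cpd :: "nat \<Rightarrow> real \<Rightarrow> (nat \<Rightarrow> real) \<Rightarrow> real \<Rightarrow> real" where
  "tail_cpd N t c y = tail_measure N t c {..<y} + t * tail_measure N t c {y}"

definition cpd_atom ::
  "nat \<Rightarrow> nat \<Rightarrow> ((nat \<Rightarrow> 'p obs) \<Rightarrow> 'p obs \<Rightarrow> real) \<Rightarrow>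
   ((nat \<Rightarrow> 'p obs) \<Rightarrow> real ^ 'p \<Rightarrow> real \<Rightarrow> real) \<Rightarrow> (nat \<Rightarrow> 'p obs) \<Rightarrow> nat \<Rightarrow> real" where
  "cpd_atom m n E sol z = order_stat (n - m) (conformal_atom m n E sol z)"

definition cpd ::
  "nat \<Rightarrow> nat \<Rightarrow> ((nat \<Rightarrow> 'p obs) \<Rightarrow> 'p obs \<Rightarrow> real) \<Rightarrow>
   ((nat \<Rightarrow> 'p obs) \<Rightarrow> real ^ 'p \<Rightarrow> real \<Rightarrow> real) \<Rightarrow> real \<Rightarrow> (nat \<Rightarrow> 'p obs) \<Rightarrow> real \<Rightarrow> real" where
  "cpd m n E sol t z = tail_cpd (n - m) t (cpd_atom m n E sol z)"

(* "f s x" is the value at x of the point predictor fitted on the training sequence s *)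
definition residual :: "nat \<Rightarrow> ((nat \<Rightarrow> 'p obs) \<Rightarrow> real ^ 'p \<Rightarrow> real) \<Rightarrow> (nat \<Rightarrow> 'p obs) \<Rightarrow> nat \<Rightarrow> real" where
  "residual m f z j = snd (z j) - f (training m z) (fst (z j))"

definition qm_value ::
  "nat \<Rightarrow> nat \<Rightarrow> ((nat \<Rightarrow> 'p obs) \<Rightarrow> real ^ 'p \<Rightarrow> real) \<Rightarrow> (nat \<Rightarrow> 'p obs) \<Rightarrow> nat \<Rightarrow> real" where
  "qm_value m n f z i = f (training m z) (fst (z (n + 1))) + residual m f z (m + i)"

definition alpha :: "nat \<Rightarrow> nat \<Rightarrow> real" where
  "alpha K i = real i / real K"

(* y^{alpha_i} as an extended real; a i is the i-th smallest of N values *)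
definition qm_quantile :: "nat \<Rightarrow> nat \<Rightarrow> (nat \<Rightarrow> real) \<Rightarrow> nat \<Rightarrow> ereal" where
  "qm_quantile N K a i =
     (if i = 0 then -\<infinity> else if i = K then \<infinity>
      else ereal (a (nat \<lceil>real (N + 1) * alpha K i\<rceil>)))"

definition qm_cdf :: "nat \<Rightarrow> nat \<Rightarrow> (nat \<Rightarrow> real) \<Rightarrow> real \<Rightarrow> real" where
  "qm_cdf N K a y =
     (if a 1 \<le> y then Inf {alpha K i | i. i \<le> K \<and> ereal y < qm_quantile N K a i} else 0)"

definition qm_step_atom :: "nat \<Rightarrow> nat \<Rightarrow> (nat \<Rightarrow> real) \<Rightarrow> nat \<Rightarrow> real" where
  "qm_step_atom N K a i = (if i = 1 then a 1 else real_of_ereal (qm_quantile N K a (i - 1)))"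

definition qm_atom ::
  "nat \<Rightarrow> nat \<Rightarrow> nat \<Rightarrow> ((nat \<Rightarrow> 'p obs) \<Rightarrow> real ^ 'p \<Rightarrow> real) \<Rightarrow> (nat \<Rightarrow> 'p obs) \<Rightarrow> nat \<Rightarrow> real" where
  "qm_atom m n K f z = qm_step_atom (n - m) K (order_stat (n - m) (qm_value m n f z))"

definition qm ::
  "nat \<Rightarrow> nat \<Rightarrow> nat \<Rightarrow> ((nat \<Rightarrow> 'p obs) \<Rightarrow> real ^ 'p \<Rightarrow> real) \<Rightarrow> (nat \<Rightarrow> 'p obs) \<Rightarrow> real \<Rightarrow> real" where
  "qm m n K f z = qm_cdf (n - m) K (order_stat (n - m) (qm_value m n f z))"

(* The two step functions above have the jump masses one expects at distinct sorted atoms. *)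
lemma tendsto_tail_right: "(tail_cpd N t c \<longlongrightarrow> tail_measure N t c {..x}) (at_right x)"
proof -
  have "((\<lambda>y. tail_mass N t i * indicator {..<y} (c i)) \<longlongrightarrow> tail_mass N t i * indicator {..x} (c i)) (at_right x)" for i
  proof (rule tendsto_eventually)
    show "\<forall>\<^sub>F y in at_right x. tail_mass N t i * indicator {..<y} (c i) = tail_mass N t i * indicator {..x} (c i)"
    proof (cases "c i \<le> x")
      case True
      then show ?thesis by (auto simp: eventually_at_right_field indicator_def intro!: exI[of _ "x+1"])
    next
      case False
      then show ?thesis by (auto simp: eventually_at_right_field indicator_def intro!: exI[of _ "c i"])
    qed
  qed
  moreover have "((\<lambda>y. tail_mass N t i * indicator {y} (c i)) \<longlongrightarrow> 0) (at_right x)" for i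
  proof (rule tendsto_eventually)
    show "\<forall>\<^sub>F y in at_right x. tail_mass N t i * indicator {y} (c i) = 0"
    proof (cases "c i \<le> x")
      case True
      then show ?thesis by (auto simp: eventually_at_right_field indicator_def intro!: exI[of _ "x+1"])
    next
      case False
      then show ?thesis by (auto simp: eventually_at_right_field indicator_def intro!: exI[of _ "c i"])
    qed
  qed
  ultimately have "((\<lambda>y. (\<Sum>i=1..N. tail_mass N t i * indicator {..<y} (c i)) + t * (\<Sum>i=1..N. tail_mass N t i * indicator {y} (c i)))
     \<longlongrightarrow> (\<Sum>i=1..N. tail_mass N t i * indicator {..x} (c i)) + t * (\<Sum>i=1..N. 0)) (at_right x)"
    by (intro tendsto_add tendsto_mult_left[where c = t] tendsto_sum)
  then show ?thesis by (simp add: tail_cpd_def[abs_def] tail_measure_def)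
qed

lemma tendsto_tail_left: 
  assumes "\<And>i. i \<in> {1..N} \<Longrightarrow> x \<le> c i"
  shows "(tail_cpd N t c \<longlongrightarrow> 0) (at_left x)"
proof (rule tendsto_eventually)
  have "tail_cpd N t c y = 0" if "y < x" for y
  proof -
    have "tail_mass N t i * indicator {..<y} (c i) = 0" "tail_mass N t i * indicator {y} (c i) = 0" if "i \<in> {1..N}" for i
      using assms[OF that] \<open>y < x\<close> by (auto simp: indicator_def)
    then have "tail_measure N t c {..<y} = 0" "tail_measure N t c {y} = 0"
      unfolding tail_measure_def by (intro sum.neutral ballI; blast)+
    then show ?thesis by (simp add: tail_cpd_def)
  qed
  then show "\<forall>\<^sub>F y in at_left x. tail_cpd N t c y = 0"
    by (auto simp: eventually_at_left_field intro!: exI[of _ "x-1"])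
qed

lemma jump_mass_tail_cpd:
  assumes c: "strict_mono_on {1..N} c" and i: "i \<in> {1..N}"
  shows "jump_mass (tail_cpd N t c) c i = tail_mass N t i"
proof -
  let ?F = "\<lambda>k. \<Sum>j=1..k. tail_mass N t j"
  have le: "c j \<le> c k \<longleftrightarrow> j \<le> k" if "j \<in> {1..N}" "k \<in> {1..N}" for j k
    using strict_mono_on_less_eq[OF c] that by auto
  have R: "step_level (tail_cpd N t c) c k = ?F k" if "k \<in> {1..N}" for k
  proof -
    have "Lim (at_right (c k)) (tail_cpd N t c) = tail_measure N t c {..c k}"
      by (intro tendsto_Lim tendsto_tail_right) simp
    also have "\<dots> = (\<Sum>j=1..N. if j \<in> {1..k} then tail_mass N t j else 0)"
      unfolding tail_measure_def using le that by (intro sum.cong) (auto simp: indicator_def)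
    also have "\<dots> = ?F k"
      using that by (subst sum.inter_restrict[symmetric]) (auto intro!: sum.cong)
    finally show ?thesis using that by (auto simp: step_level_def)
  qed
  have L: "step_level (tail_cpd N t c) c 0 = 0"
  proof -
    have "Lim (at_left (c 1)) (tail_cpd N t c) = 0"
      using i le by (intro tendsto_Lim tendsto_tail_left) auto
    then show ?thesis by (simp add: step_level_def)
  qed
  show ?thesis
  proof (cases "i = 1")
    case True
    then show ?thesis using R[OF i] L by (simp add: jump_mass_def)
  next
    case False
    then obtain k where k: "i = Suc k" "k \<in> {1..N}" using i by (cases i) auto
    then show ?thesis using R[OF i] R[OF k(2)] by (simp add: jump_mass_def)
  qed
qed

lemma sum_tail_mass: "0 < N \<Longrightarrow> (\<Sum>i=1..N. tail_mass N t i) = 1"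
  by (simp add: tail_mass_def sum_divide_distrib[symmetric] sum.distrib)
 

lemma qm_step_atom_mono:
  assumes a: "strict_mono_on {1..N} a" and K: "0 < K" "K < N + 1"
  shows "strict_mono_on {1..K} (qm_step_atom N K a)"
proof -
  define J where "J k = (if k = 1 then 1 else nat \<lceil>real (N + 1) * alpha K (k - 1)\<rceil>)" for k
  have eq: "qm_step_atom N K a k = a (J k)" if "k \<in> {1..K}" for k
    using that by (auto simp: qm_step_atom_def qm_quantile_def J_def)
  have one: "1 < real (N + 1) / real K" using K by (simp add: field_simps)
  have alpha: "real (N + 1) * alpha K i = real (N + 1) / real K * real i" for i
    by (simp add: alpha_def)
  have step: "real (N + 1) * alpha K i + 1 < real (N + 1) * alpha K j" if "i < j" for i j
  proof -
    have "real (N + 1) / real K * 1 \<le> real (N + 1) / real K * (real j - real i)"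
      using that by (intro mult_left_mono) auto
    then show ?thesis using one unfolding alpha by (simp add: right_diff_distrib)
  qed
  have JN: "J k \<in> {1..N}" if "k \<in> {1..K}" for k
  proof (cases "k = 1")
    case False
    have "real (N + 1) * alpha K 0 + 1 < real (N + 1) * alpha K (k - 1)"
      using that False by (intro step) auto
    moreover have "real (N + 1) * alpha K (k - 1) + 1 < real (N + 1) * alpha K K"
      using that K by (intro step) auto
    moreover have "real (N + 1) * alpha K 0 = 0" "real (N + 1) * alpha K K = real N + 1"
      using K by (simp_all add: alpha_def)
    ultimately have "1 < real (N + 1) * alpha K (k - 1)" "real (N + 1) * alpha K (k - 1) < real N"
      by linarith+
    then have "1 \<le> \<lceil>real (N + 1) * alpha K (k - 1)\<rceil>" "\<lceil>real (N + 1) * alpha K (k - 1)\<rceil> \<le> int N"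
      by linarith+
    moreover have "nat x \<in> {1..N}" if "1 \<le> x" "x \<le> int N" for x :: int
      using that by auto
    ultimately have "nat \<lceil>real (N + 1) * alpha K (k - 1)\<rceil> \<in> {1..N}" by blast
    then show ?thesis unfolding J_def using False by (simp only: if_False)
  qed (use K in \<open>auto simp: J_def\<close>)
  have Jm: "J k < J l" if "k \<in> {1..K}" "l \<in> {1..K}" "k < l" for k l
  proof -
    have s: "real (N + 1) * alpha K (k - 1) + 1 < real (N + 1) * alpha K (l - 1)"
      using that by (intro step) auto
    have z: "0 \<le> real (N + 1) * alpha K (k - 1)" by (simp add: alpha_def)
    have "\<lceil>real (N + 1) * alpha K (k - 1)\<rceil> < \<lceil>real (N + 1) * alpha K (l - 1)\<rceil>"
      "1 < \<lceil>real (N + 1) * alpha K (l - 1)\<rceil>" "0 \<le> \<lceil>real (N + 1) * alpha K (k - 1)\<rceil>"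
      using s z by linarith+
    then show ?thesis using that by (auto simp: J_def)
  qed
  show ?thesis
  proof (rule strict_mono_onI)
    fix k l assume "k \<in> {1..K}" "l \<in> {1..K}" "k < l"
    then show "qm_step_atom N K a k < qm_step_atom N K a l"
      using strict_mono_onD[OF a JN JN Jm] by (simp add: eq)
  qed
qed

lemma jump_mass_qm_cdf:
  assumes a: "strict_mono_on {1..N} a" and K: "0 < K" "K < N + 1" and i: "i \<in> {1..K}"
  shows "jump_mass (qm_cdf N K a) (qm_step_atom N K a) i = 1 / real K"
proof -
  let ?c = "qm_step_atom N K a" and ?Q = "qm_cdf N K a"
  note c = qm_step_atom_mono[OF a K]
  have le: "?c j \<le> ?c k \<longleftrightarrow> j \<le> k" if "j \<in> {1..K}" "k \<in> {1..K}" for j k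
    using strict_mono_on_less_eq[OF c] that by auto
  have c1: "?c 1 = a 1" by (simp add: qm_step_atom_def)
  have q: "qm_quantile N K a j = ereal (?c (j + 1))" if "0 < j" "j < K" for j
    using that by (simp add: qm_step_atom_def qm_quantile_def)
  have val: "?Q y = alpha K k" if k: "k \<in> {1..K}" and y: "?c k \<le> y" "k < K \<Longrightarrow> y < ?c (k + 1)" for k y
  proof -
    have "a 1 \<le> y" using le[of 1 k] k y c1 by force
    moreover have "{alpha K j | j. j \<le> K \<and> ereal y < qm_quantile N K a j} = alpha K ` {k..K}"
    proof -
      have "ereal y < qm_quantile N K a j \<longleftrightarrow> k \<le> j" if "j \<le> K" for j
      proof -
        consider "j = 0" | "j = K" | "0 < j" "j < K" using \<open>j \<le> K\<close> by force
        then show ?thesis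
        proof cases
          case 3
          show ?thesis
          proof
            assume "ereal y < qm_quantile N K a j"
            then have "\<not> ?c (j + 1) \<le> ?c k" using y q[OF 3] by simp
            then show "k \<le> j" using le[of "j + 1" k] 3 k by auto
          next
            assume "k \<le> j"
            then have "?c (k + 1) \<le> ?c (j + 1)" using le[of "k + 1" "j + 1"] 3 k by auto
            then show "ereal y < qm_quantile N K a j" using y(2) \<open>k \<le> j\<close> q[OF 3] 3 by simp
          qed
        qed (use k K in \<open>auto simp: qm_quantile_def\<close>)
      qed
      then show ?thesis by (auto simp: image_iff)
    qed
    moreover have "Inf (alpha K ` {k..K}) = alpha K k"
      using k by (intro cInf_eq_minimum) (auto simp: alpha_def divide_right_mono)
    ultimately show ?thesis by (simp add: qm_cdf_def)
  qed
  have R: "step_level ?Q ?c k = alpha K k" if k: "k \<in> {1..K}" for k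
  proof -
    obtain b where b: "?c k < b" "k < K \<Longrightarrow> b \<le> ?c (k + 1)"
    proof (cases "k < K")
      case True
      then show ?thesis using that[of "?c (k + 1)"] strict_mono_onD[OF c, of k "k + 1"] k by auto
    next
      case False
      then show ?thesis using that[of "?c k + 1"] by auto
    qed
    have "(?Q \<longlongrightarrow> alpha K k) (at_right (?c k))"
      using b val[OF k] by (intro tendsto_eventually) (force simp: eventually_at_right_field)
    then have "Lim (at_right (?c k)) ?Q = alpha K k" by (intro tendsto_Lim) auto
    then show ?thesis using k by (simp add: step_level_def)
  qed
  have L: "step_level ?Q ?c 0 = alpha K 0"
  proof -
    have "(?Q \<longlongrightarrow> 0) (at_left (?c 1))"
      by (intro tendsto_eventually)
        (auto simp: eventually_at_left_field qm_cdf_def c1[simplified] intro!: exI[of _ "a 1 - 1"])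
    then have "Lim (at_left (?c 1)) ?Q = 0" by (intro tendsto_Lim) auto
    then show ?thesis by (simp add: step_level_def alpha_def)
  qed
  have "step_level ?Q ?c (i - 1) = alpha K (i - 1)"
  proof (cases "i = 1")
    case True
    then show ?thesis using L by simp
  next
    case False
    then have "i - 1 \<in> {1..K}" using i by auto
    then show ?thesis by (rule R)
  qed
  then show ?thesis using R[OF i] i
    by (simp add: jump_mass_def alpha_def of_nat_diff diff_divide_distrib)
qed

end

theory Submission
  imports Defs
begin

text \<open>
  Let \<open>N = n - m\<close> and let \<open>R\<close> be the number of calibration scores below the score of the test point.
  The scores are exchangeable and almost surely distinct, so \<open>R\<close> is uniform on \<open>{0..N}\<close>. Since \<open>R\<close>
  also counts the atoms (before thinning, in the case of quantile matching) below \<open>Y\<^sub>n\<^sub>+\<^sub>1\<close>,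
  monotonicity of the smoothed CDF and fidelity at the two neighbouring atoms give
  \<open>R / (N + 1) - a \<le> Q\<^sup>h (Y\<^sub>n\<^sub>+\<^sub>1) \<le> R / (N + 1) + b\<close>, with
  \<open>a = \<epsilon> + 1 / (2 (N + 1))\<close>, \<open>b = \<epsilon> + 3 / (2 (N + 1))\<close> for the tail-corrected distribution and
  \<open>a = \<epsilon> + 1 / (2 K)\<close>, \<open>b = \<epsilon> + 3 / (2 K)\<close> for quantile matching. Consequently
  \<open>u - b \<le> P (Q\<^sup>h (Y\<^sub>n\<^sub>+\<^sub>1) \<le> u) \<le> u + a + 1 / (N + 1)\<close>.
  For \<open>N = 1\<close> the atoms give no information on ties of the scores, but then the only jump has mass
  \<open>1\<close> and the claimed bound exceeds \<open>1\<close>.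
\<close>

section \<open>Order statistics\<close>

text \<open>The entries below \<open>y\<close> form a prefix of a sorted list, so the zero-based
  position \<open>k\<close> belongs to it exactly when \<open>k\<close> is less than its
  length.\<close>

lemma length_filter_less_iff_nth_less:
  fixes xs :: "'a::linorder list"
  assumes "sorted xs" "k < length xs"
  shows "xs ! k < y \<longleftrightarrow> k < length (filter (\<lambda>x. x < y) xs)"
  using assms
proof (induction xs arbitrary: k)
  case (Cons x xs)
  show ?case
  proof (cases "x < y")
    case True
    then show ?thesis using Cons by (cases k) auto
  next
    case False
    then have "filter (\<lambda>x. x < y) xs = []"
      using Cons.prems by (auto simp: filter_empty_conv)
    moreover have "\<not> (x # xs) ! k < y"
      using False Cons.prems by (cases k) (force simp: not_less dest: nth_mem)+
    ultimately show ?thesis using False by simp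
  qed
qed simp

text \<open>Sorting does not change how many values are below \<open>y\<close>, with or without
  ties. This turns comparisons of \<open>y\<close> with sorted atoms into comparisons of indices
  with a rank.\<close>

lemma order_stat_less_iff:
  assumes "i \<in> {1..N}"
  shows "order_stat N f i < y \<longleftrightarrow> i \<le> card {j\<in>{1..N}. f j < y}"
proof -
  let ?xs = "map f [1..<Suc N]"
  have "length (filter (\<lambda>x. x < y) (sort ?xs)) = length (filter (\<lambda>x. x < y) ?xs)"
    by (metis filter_sort length_sort)
  also have "\<dots> = length (filter (\<lambda>j. f j < y) [1..<Suc N])"
    by (simp only: filter_map comp_def length_map)
  also have "\<dots> = card {j\<in>{1..N}. f j < y}"
    by (subst distinct_length_filter) (auto intro: arg_cong[where f = card])
  finally show ?thesis
    using length_filter_less_iff_nth_less[of "sort ?xs" "i - 1" y] assms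
    unfolding order_stat_def by (simp del: upt_Suc) linarith
qed

lemma order_stat_mono:
  assumes "1 \<le> i" "i \<le> j" "j \<le> N"
  shows "order_stat N f i \<le> order_stat N f j"
  unfolding order_stat_def using assms by (intro sorted_nth_mono) (auto simp del: upt_Suc)

lemma order_stat_strict_mono:
  assumes "inj_on f {1..N}"
  shows "strict_mono_on {1..N} (order_stat N f)"
proof (rule strict_mono_onI)
  fix i j assume ij: "i \<in> {1..N}" "j \<in> {1..N}" "i < j"
  have "{1..<Suc N} = {1..N}" by auto
  then have "distinct (sort (map f [1..<Suc N]))"
    using assms by (simp add: distinct_map del: upt_Suc)
  then have "order_stat N f i \<noteq> order_stat N f j"
    unfolding order_stat_def using ij by (subst nth_eq_iff_index_eq) (auto simp del: upt_Suc)
  then show "order_stat N f i < order_stat N f j"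
    using order_stat_mono[of i j N f] ij by auto
qed

text \<open>By the counting criterion, the events to be measured only ask whether a count of
  measurable events reaches \<open>i\<close>.\<close>

lemma measurable_order_stat:
  assumes [measurable]: "\<And>j. j \<in> {1..N} \<Longrightarrow> (\<lambda>w. f w j) \<in> borel_measurable M"
    and i: "i \<in> {1..N}"
  shows "(\<lambda>w. order_stat N (f w) i) \<in> borel_measurable M"
  unfolding borel_measurable_iff_less
proof
  fix y :: real
  have "(\<lambda>w. card {j\<in>{1..N}. f w j < y}) \<in> measurable M (count_space UNIV)"
  proof (rule measurable_card)
    fix j show "{w \<in> space M. j \<in> {j\<in>{1..N}. f w j < y}} \<in> sets M"
      by (cases "j \<in> {1..N}") auto
  qed
  then have "{w \<in> space M. i \<le> card {j\<in>{1..N}. f w j < y}} \<in> sets M"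
    by measurable
  then show "{w \<in> space M. order_stat N (f w) i < y} \<in> sets M"
    using order_stat_less_iff[OF i] by simp
qed

section \<open>Smoothed step functions\<close>

lemma kernel_cdf_mono:
  assumes "kernel \<kappa>"
  shows "mono (kernel_cdf \<kappa>)"
proof (rule monoI)
  fix s t :: real assume "s \<le> t"
  have "set_integrable lborel A \<kappa>" if "A \<in> sets borel" for A
    using assms that unfolding kernel_def set_integrable_def
    by (intro integrable_mult_indicator) auto
  from this[of "{..s}"] this[of "{..t}"] show "kernel_cdf \<kappa> s \<le> kernel_cdf \<kappa> t"
    unfolding kernel_cdf_def set_lebesgue_integral_def set_integrable_def
    using assms \<open>s \<le> t\<close>
    by (intro integral_mono) (auto simp: indicator_def kernel_def)
qed

lemma kernel_cdf_nonneg: "kernel \<kappa> \<Longrightarrow> 0 \<le> kernel_cdf \<kappa> t"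
  unfolding kernel_cdf_def set_lebesgue_integral_def
  by (intro integral_nonneg_AE) (auto simp: kernel_def)

lemma kernel_cdf_le_1:
  assumes "kernel \<kappa>"
  shows "kernel_cdf \<kappa> t \<le> 1"
proof -
  have "kernel_cdf \<kappa> t \<le> integral\<^sup>L lborel \<kappa>"
    unfolding kernel_cdf_def set_lebesgue_integral_def using assms
    by (intro integral_mono integrable_mult_indicator) (auto simp: indicator_def kernel_def)
  then show ?thesis using assms by (simp add: kernel_def)
qed

lemma smoothed_cdf_mono:
  assumes "kernel \<kappa>" "0 < h" "\<And>i. i \<in> {1..M} \<Longrightarrow> 0 \<le> jump_mass Q c i" "x \<le> y"
  shows "smoothed_cdf \<kappa> Q c M h x \<le> smoothed_cdf \<kappa> Q c M h y"
  unfolding smoothed_cdf_def using assms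
  by (intro sum_mono mult_left_mono monoD[OF kernel_cdf_mono] divide_right_mono) auto

lemma smoothed_cdf_nonneg:
  assumes "kernel \<kappa>" "\<And>i. i \<in> {1..M} \<Longrightarrow> 0 \<le> jump_mass Q c i"
  shows "0 \<le> smoothed_cdf \<kappa> Q c M h y"
  unfolding smoothed_cdf_def using assms
  by (intro sum_nonneg mult_nonneg_nonneg kernel_cdf_nonneg) auto

lemma smoothed_cdf_le_1:
  assumes "kernel \<kappa>" "\<And>i. i \<in> {1..M} \<Longrightarrow> 0 \<le> jump_mass Q c i"
    and "(\<Sum>i=1..M. jump_mass Q c i) = 1"
  shows "smoothed_cdf \<kappa> Q c M h y \<le> 1"
proof -
  have "smoothed_cdf \<kappa> Q c M h y \<le> (\<Sum>i=1..M. jump_mass Q c i * 1)"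
    unfolding smoothed_cdf_def using assms
    by (intro sum_mono mult_left_mono kernel_cdf_le_1) auto
  then show ?thesis using assms(3) by simp
qed

lemma fidelityD:
  assumes "fidelity \<kappa> Q c M h \<epsilon>" "j \<in> {1..M}"
  shows "\<bar>smoothed_cdf \<kappa> Q c M h (c j) - midpoint_target Q c j\<bar> \<le> \<epsilon>"
  using assms unfolding fidelity_def by (subst (asm) Max_le_iff) auto

text \<open>Fidelity speaks about the atoms only; monotonicity of the smoothed CDF carries the bound
  from an atom to every point on its right. The next lemma is the mirror image.\<close>

lemma smoothed_cdf_ge_target:
  assumes "kernel \<kappa>" "0 < h" "\<And>i. i \<in> {1..M} \<Longrightarrow> 0 \<le> jump_mass Q c i"
    and "fidelity \<kappa> Q c M h \<epsilon>" "j \<in> {1..M}" "c j \<le> y"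
  shows "midpoint_target Q c j - \<epsilon> \<le> smoothed_cdf \<kappa> Q c M h y"
  using fidelityD[OF assms(4,5)] smoothed_cdf_mono[OF assms(1-2) _ assms(6), of M Q c] assms(3)
  by force

lemma smoothed_cdf_le_target:
  assumes "kernel \<kappa>" "0 < h" "\<And>i. i \<in> {1..M} \<Longrightarrow> 0 \<le> jump_mass Q c i"
    and "fidelity \<kappa> Q c M h \<epsilon>" "j \<in> {1..M}" "y \<le> c j"
  shows "smoothed_cdf \<kappa> Q c M h y \<le> midpoint_target Q c j + \<epsilon>"
  using fidelityD[OF assms(4,5)] smoothed_cdf_mono[OF assms(1-2) _ assms(6), of M Q c] assms(3)
  by force

lemma step_level_eq_sum_jump_mass:
  "step_level Q c k = step_level Q c 0 + (\<Sum>i=1..k. jump_mass Q c i)"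
  by (induction k) (simp_all add: jump_mass_def)

text \<open>Measurability must hold on the null event of tied atoms as well, because \<^term>\<open>measure\<close> is \<open>0\<close>
  on non-measurable sets and the probability space need not be complete. Hence the one-sided limits
  are computed below without assuming distinct atoms.\<close>

lemma measurable_smoothed_cdf:
  assumes "kernel \<kappa>"
    and lev: "\<And>i. i \<in> {0..K} \<Longrightarrow> (\<lambda>w. step_level (Q w) (c w) i) \<in> borel_measurable M"
    and c: "\<And>i. i \<in> {1..K} \<Longrightarrow> (\<lambda>w. c w i) \<in> borel_measurable M"
    and [measurable]: "h \<in> borel_measurable M" "y \<in> borel_measurable M"
  shows "(\<lambda>w. smoothed_cdf \<kappa> (Q w) (c w) K (h w) (y w)) \<in> borel_measurable M"
  unfolding smoothed_cdf_def jump_mass_def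
proof (rule borel_measurable_sum)
  fix i assume i: "i \<in> {1..K}"
  have [measurable]: "kernel_cdf \<kappa> \<in> borel_measurable borel"
    by (intro borel_measurable_mono kernel_cdf_mono assms)
  have [measurable]: "(\<lambda>w. step_level (Q w) (c w) i) \<in> borel_measurable M"
    "(\<lambda>w. step_level (Q w) (c w) (i - 1)) \<in> borel_measurable M"
    "(\<lambda>w. c w i) \<in> borel_measurable M"
    using i by (auto intro: lev c)
  show "(\<lambda>w. (step_level (Q w) (c w) i - step_level (Q w) (c w) (i - 1)) *
      kernel_cdf \<kappa> ((y w - c w i) / h w)) \<in> borel_measurable M"
    by measurable
qed

section \<open>Exchangeable scores and ranks\<close>

text \<open>A permutation of \<open>J\<close> fixes the indices in \<open>T\<close>, so permuting
  the scores amounts to permuting the whole sequence while the training data stay in place.\<close>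

lemma exchangeable_scores:
  fixes Z :: "nat \<Rightarrow> 'w \<Rightarrow> 'b::topological_space"
  assumes ex: "exchangeable M I Z" and TJ: "T \<inter> J = {}" "T \<union> J \<subseteq> I"
    and g: "(\<lambda>(z, a). g z a) \<in> borel_measurable ((\<Pi>\<^sub>M i\<in>T. borel) \<Otimes>\<^sub>M borel)"
  shows "exchangeable M J (\<lambda>j w. g (\<lambda>i\<in>T. Z i w) (Z j w) :: real)"
  unfolding exchangeable_def
proof (intro conjI ballI allI impI)
  have Z: "Z i \<in> borel_measurable M" if "i \<in> I" for i
    using ex that by (auto simp: exchangeable_def)
  fix j assume "j \<in> J"
  then have [measurable]: "Z j \<in> borel_measurable M" using TJ by (auto intro: Z)
  have [measurable]: "(\<lambda>w. \<lambda>i\<in>T. Z i w) \<in> measurable M (\<Pi>\<^sub>M i\<in>T. borel)"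
    using TJ by (intro measurable_restrict Z) auto
  have "(\<lambda>w. case ((\<lambda>i\<in>T. Z i w), Z j w) of (z, a) \<Rightarrow> g z a) \<in> borel_measurable M"
    by (rule measurable_compose[OF _ g]) measurable
  then show "(\<lambda>w. g (\<lambda>i\<in>T. Z i w) (Z j w)) \<in> borel_measurable M" by simp
next
  have Z: "Z i \<in> borel_measurable M" if "i \<in> I" for i
    using ex that by (auto simp: exchangeable_def)
  fix \<pi> assume \<pi>: "\<pi> permutes J"
  then have \<pi>I: "\<pi> permutes I" using TJ by (auto intro: permutes_subset)
  \<comment> \<open>\<open>\<Phi>\<close> reads off all scores from one whole sequence. No
    permutation enters it, so the same map serves both laws.\<close>
  define \<Phi> where "\<Phi> z = (\<lambda>j\<in>J. g (restrict z T) (z j))" for z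
  have \<Phi> [measurable]: "\<Phi> \<in> measurable (\<Pi>\<^sub>M i\<in>I. borel) (\<Pi>\<^sub>M j\<in>J. borel)"
    unfolding \<Phi>_def
  proof (rule measurable_restrict)
    fix j assume "j \<in> J"
    then have comp: "(\<lambda>z. z j) \<in> measurable (\<Pi>\<^sub>M i\<in>I. borel :: 'b measure) borel"
      using TJ by (intro measurable_component_singleton) auto
    have restr: "(\<lambda>z. restrict z T) \<in> measurable (\<Pi>\<^sub>M i\<in>I. borel :: 'b measure) (\<Pi>\<^sub>M i\<in>T. borel)"
      using TJ by (intro measurable_restrict_subset) blast
    from measurable_compose[OF measurable_Pair[OF restr comp] g]
    show "(\<lambda>z. g (restrict z T) (z j)) \<in> borel_measurable (\<Pi>\<^sub>M i\<in>I. borel)" by simp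
  qed
  have push: "distr M (\<Pi>\<^sub>M j\<in>J. borel) (\<lambda>w. \<lambda>j\<in>J. g (\<lambda>i\<in>T. Z i w) (Z (\<sigma> j) w)) =
      distr (distr M (\<Pi>\<^sub>M i\<in>I. borel) (\<lambda>w. \<lambda>i\<in>I. Z (\<sigma> i) w)) (\<Pi>\<^sub>M j\<in>J. borel) \<Phi>"
    if \<sigma>: "\<sigma> permutes J" for \<sigma>
  proof -
    have "\<sigma> permutes I" using \<sigma> TJ by (auto intro: permutes_subset)
    then have "(\<lambda>w. \<lambda>i\<in>I. Z (\<sigma> i) w) \<in> measurable M (\<Pi>\<^sub>M i\<in>I. borel)"
      by (intro measurable_restrict Z) (auto simp: permutes_in_image)
    moreover have "\<sigma> i = i" if "i \<in> T" for i
      using \<sigma> TJ that by (intro permutes_not_in[OF \<sigma>]) auto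
    then have "restrict (\<lambda>i\<in>I. Z (\<sigma> i) w) T = (\<lambda>i\<in>T. Z i w)" for w
      using TJ by (intro ext) (auto simp: restrict_def)
    then have "\<Phi> \<circ> (\<lambda>w. \<lambda>i\<in>I. Z (\<sigma> i) w) = (\<lambda>w. \<lambda>j\<in>J. g (\<lambda>i\<in>T. Z i w) (Z (\<sigma> j) w))"
      using TJ by (intro ext) (auto simp: \<Phi>_def simp del: restrict_restrict)
    ultimately show ?thesis by (simp add: distr_distr)
  qed
  have "distr M (\<Pi>\<^sub>M i\<in>I. borel) (\<lambda>w. \<lambda>i\<in>I. Z (\<pi> i) w) = distr M (\<Pi>\<^sub>M i\<in>I. borel) (\<lambda>w. \<lambda>i\<in>I. Z i w)"
    using ex \<pi>I by (auto simp: exchangeable_def)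
  then show "distr M (\<Pi>\<^sub>M j\<in>J. borel) (\<lambda>w. \<lambda>j\<in>J. g (\<lambda>i\<in>T. Z i w) (Z (\<pi> j) w)) =
      distr M (\<Pi>\<^sub>M j\<in>J. borel) (\<lambda>w. \<lambda>j\<in>J. g (\<lambda>i\<in>T. Z i w) (Z j w))"
    using push[OF \<pi>] push[OF permutes_id] by (simp add: id_def)
qed

lemma exchangeable_measure_eq:
  assumes ex: "exchangeable M J S" and \<pi>: "\<pi> permutes J"
    and P: "Measurable.pred (\<Pi>\<^sub>M j\<in>J. borel) P"
  shows "measure M {w \<in> space M. P (\<lambda>j\<in>J. S (\<pi> j) w)} = measure M {w \<in> space M. P (\<lambda>j\<in>J. S j w)}"
proof -
  have S: "(\<lambda>w. \<lambda>j\<in>J. S (\<sigma> j) w) \<in> measurable M (\<Pi>\<^sub>M j\<in>J. borel)" if "\<sigma> permutes J" for \<sigma>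
    using ex that by (intro measurable_restrict) (auto simp: exchangeable_def permutes_in_image)
  let ?A = "{s \<in> space (\<Pi>\<^sub>M j\<in>J. borel). P s}"
  have "measure M {w \<in> space M. P (\<lambda>j\<in>J. S (\<sigma> j) w)} =
      measure (distr M (\<Pi>\<^sub>M j\<in>J. borel) (\<lambda>w. \<lambda>j\<in>J. S (\<sigma> j) w)) ?A" if "\<sigma> permutes J" for \<sigma>
  proof (subst measure_distr[OF S[OF that]])
    show "?A \<in> sets (\<Pi>\<^sub>M j\<in>J. borel)" using P by measurable
  qed (auto simp: space_PiM intro!: arg_cong[where f = "measure M"])
  from this[OF \<pi>] this[OF permutes_id] show ?thesis
    using ex \<pi> by (simp add: exchangeable_def id_def)
qed

text \<open>Without ties a smaller element has a strictly smaller rank, so the rank is an injection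
  of \<open>J\<close> into \<open>{..<card J}\<close> and, by counting, a bijection.\<close>

lemma card_rank_eq:
  fixes s :: "'i \<Rightarrow> 'a::linorder"
  assumes J: "finite J" and inj: "inj_on s J" and r: "r < card J"
  shows "card {k\<in>J. card {j\<in>J. s j < s k} = r} = 1"
proof -
  let ?f = "\<lambda>k. card {j\<in>J. s j < s k}"
  have lt: "?f k < ?f l" if "k \<in> J" "s k < s l" for k l
    using J that by (intro psubset_card_mono) auto
  have inj_f: "inj_on ?f J"
  proof (rule inj_onI)
    fix k l assume kl: "k \<in> J" "l \<in> J" "?f k = ?f l"
    then have "\<not> s k < s l" "\<not> s l < s k" using lt[of k l] lt[of l k] by auto
    then show "k = l" using inj kl by (auto dest: inj_onD)
  qed
  have "?f k < card J" if "k \<in> J" for k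
    using J that by (intro psubset_card_mono) auto
  then have "?f ` J = {..<card J}"
    using J inj_f by (intro card_subset_eq) (auto simp: card_image)
  then obtain k where k: "k \<in> J" "?f k = r" using r by (metis (no_types, lifting) image_iff lessThan_iff)
  then have "{l\<in>J. ?f l = r} = {k}" using inj_f by (auto dest: inj_onD)
  then show ?thesis by simp
qed

lemma measurable_rank:
  fixes S :: "nat \<Rightarrow> 'w \<Rightarrow> real"
  assumes S: "\<And>j. j \<in> J \<Longrightarrow> S j \<in> borel_measurable M" and k: "k \<in> J"
  shows "(\<lambda>w. card {j\<in>J. S j w < S k w}) \<in> measurable M (count_space UNIV)"
proof (rule measurable_card)
  fix j show "{w \<in> space M. j \<in> {j\<in>J. S j w < S k w}} \<in> sets M"
  proof (cases "j \<in> J")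
    case True
    then have [measurable]: "S j \<in> borel_measurable M" "S k \<in> borel_measurable M"
      using S k by auto
    have "{w \<in> space M. S j w < S k w} \<in> sets M" by measurable
    then show ?thesis using True by simp
  qed simp
qed

text \<open>All pairs of distinct indices tie with the same probability, because some permutation
  carries any one pair to any other. Excluding ties for a single pair thus excludes them for all of
  the finitely many pairs.\<close>

lemma exchangeable_AE_inj:
  fixes S :: "nat \<Rightarrow> 'w \<Rightarrow> real"
  assumes "prob_space M" and ex: "exchangeable M J S" and "finite J"
    and ab: "a \<in> J" "b \<in> J" "a \<noteq> b" "AE w in M. S a w \<noteq> S b w"
  shows "AE w in M. inj_on (\<lambda>j. S j w) J"
proof -
  interpret prob_space M by fact
  have S: "S j \<in> borel_measurable M" if "j \<in> J" for j
    using ex that by (auto simp: exchangeable_def)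
  have prob_eq: "prob {w \<in> space M. S (\<pi> i) w = S (\<pi> j) w} = prob {w \<in> space M. S i w = S j w}"
    if "\<pi> permutes J" "i \<in> J" "j \<in> J" for \<pi> i j
  proof -
    have "Measurable.pred (Pi\<^sub>M J (\<lambda>_. borel :: real measure)) (\<lambda>s. s i = s j)"
    proof -
      have [measurable]: "(\<lambda>s. s i) \<in> borel_measurable (Pi\<^sub>M J (\<lambda>_. borel :: real measure))"
        "(\<lambda>s. s j) \<in> borel_measurable (Pi\<^sub>M J (\<lambda>_. borel :: real measure))"
        using that by (auto intro: measurable_component_singleton)
      show ?thesis unfolding pred_def by (intro borel_measurable_eq) fact+
    qed
    from exchangeable_measure_eq[OF ex that(1) this] show ?thesis using that by simp
  qed
  have AE_iff: "(AE w in M. S i w \<noteq> S j w) \<longleftrightarrow> prob {w \<in> space M. S i w = S j w} = 0"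
    if "i \<in> J" "j \<in> J" for i j
  proof -
    have [measurable]: "S i \<in> borel_measurable M" "S j \<in> borel_measurable M"
      using S that by auto
    show ?thesis
      by (subst AE_iff_measurable[OF _ refl]) (auto simp: emeasure_eq_measure)
  qed
  have "AE w in M. S i w \<noteq> S j w" if ij: "i \<in> J" "j \<in> J" "i \<noteq> j" for i j
  proof -
    obtain \<pi> where \<pi>: "\<pi> permutes J" "\<pi> a = i" "\<pi> b = j"
    proof -
      \<comment> \<open>The first transposition sends \<open>a\<close> to \<open>i\<close> and
        \<open>b\<close> to \<open>b'\<close>. As \<open>b'\<close> and \<open>j\<close> both differ
        from \<open>i\<close>, the second one sends \<open>b'\<close> to \<open>j\<close> and fixes
        \<open>i\<close>.\<close>
      define b' where "b' = Transposition.transpose a i b"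
      define \<pi> where "\<pi> = Transposition.transpose b' j \<circ> Transposition.transpose a i"
      have b': "b' \<in> J" "b' \<noteq> i" using ab ij by (auto simp: b'_def Transposition.transpose_def)
      have "\<pi> permutes J"
        unfolding \<pi>_def using ab ij b' by (intro permutes_compose permutes_swap_id) auto
      moreover have "\<pi> a = i" "\<pi> b = j"
        using b' ij by (auto simp: \<pi>_def b'_def[symmetric])
      ultimately show ?thesis using that by blast
    qed
    show ?thesis
      using prob_eq[OF \<pi>(1) ab(1,2)] ab ij by (simp add: \<pi>(2,3) AE_iff)
  qed
  then have "AE w in M. \<forall>i\<in>J. \<forall>j\<in>J. i \<noteq> j \<longrightarrow> S i w \<noteq> S j w"
    using \<open>finite J\<close> by (intro AE_finite_allI AE_impI) auto
  then show ?thesis by eventually_elim (auto simp: inj_on_def)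
qed

text \<open>The events that index \<open>l\<close> has rank \<open>r\<close>, for \<open>l\<close>
  in \<open>J\<close>, are equally likely by exchangeability, and almost surely exactly one of them
  occurs. Their probabilities therefore add up to 1.\<close>

lemma exchangeable_rank_uniform:
  fixes S :: "nat \<Rightarrow> 'w \<Rightarrow> real"
  assumes "prob_space M" and ex: "exchangeable M J S" and J: "finite J"
    and inj: "AE w in M. inj_on (\<lambda>j. S j w) J" and k: "k \<in> J" and r: "r < card J"
  shows "measure M {w \<in> space M. card {j\<in>J. S j w < S k w} = r} = 1 / real (card J)"
proof -
  interpret prob_space M by fact
  have S: "S j \<in> borel_measurable M" if "j \<in> J" for j
    using ex that by (auto simp: exchangeable_def)
  define B where "B l = {w \<in> space M. card {j\<in>J. S j w < S l w} = r}" for l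
  have B [measurable]: "B l \<in> sets M" if "l \<in> J" for l
    using measurable_rank[of J S M, OF S that] unfolding B_def by measurable
  have eq: "prob (B l) = prob (B k)" if l: "l \<in> J" for l
  proof -
    \<comment> \<open>Swapping \<open>k\<close> and \<open>l\<close> makes the rank of
      \<open>l\<close> among the permuted scores equal to the rank of \<open>k\<close> among the
      original ones.\<close>
    define \<pi> where "\<pi> = Transposition.transpose k l"
    have \<pi>: "\<pi> permutes J" unfolding \<pi>_def using k l by (intro permutes_swap_id)
    have "(\<lambda>s. card {j\<in>J. s j < s l}) \<in> measurable (Pi\<^sub>M J (\<lambda>_. borel :: real measure)) (count_space UNIV)"
      using l by (intro measurable_rank[where S = "\<lambda>j s. s j"] measurable_component_singleton)
    then have "Measurable.pred (Pi\<^sub>M J (\<lambda>_. borel :: real measure)) (\<lambda>s. card {j\<in>J. s j < s l} = r)"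
      by measurable
    note exchangeable_measure_eq[OF ex \<pi> this]
    moreover have "card {j\<in>J. S (\<pi> j) w < S (\<pi> l) w} = card {j\<in>J. S j w < S k w}" for w
    proof -
      have "\<pi> (\<pi> j) = j" and "\<pi> l = k" for j by (simp_all add: \<pi>_def)
      then have "bij_betw \<pi> {j\<in>J. S (\<pi> j) w < S (\<pi> l) w} {j\<in>J. S j w < S k w}"
        by (intro bij_betwI[where g = \<pi>]) (auto simp: permutes_in_image[OF \<pi>])
      then show ?thesis by (rule bij_betw_same_card)
    qed
    moreover have "{j\<in>J. (\<lambda>j\<in>J. S (\<sigma> j) w) j < (\<lambda>j\<in>J. S (\<sigma> j) w) l} = {j\<in>J. S (\<sigma> j) w < S (\<sigma> l) w}" for \<sigma> w
      using l by auto
    ultimately show ?thesis by (simp add: B_def l cong: conj_cong)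
  qed
  have "real (card J) * prob (B k) = (\<Sum>l\<in>J. prob (B l))" using eq by simp
  also have "\<dots> = expectation (\<lambda>w. \<Sum>l\<in>J. indicator (B l) w)"
    using B by (subst Bochner_Integration.integral_sum) (auto simp: integrable_indicator_iff emeasure_eq_measure)
  also have "\<dots> = expectation (\<lambda>w. 1)"
  proof (rule integral_cong_AE)
    show "AE w in M. (\<Sum>l\<in>J. indicator (B l) w) = (1::real)"
      using inj AE_space
    proof eventually_elim
      case (elim w)
      have "(\<Sum>l\<in>J. indicator (B l) w) = (\<Sum>l\<in>J. if card {j\<in>J. S j w < S l w} = r then 1 else 0 :: real)"
        using elim by (intro sum.cong) (auto simp: B_def)
      also have "\<dots> = real (card {l\<in>J. card {j\<in>J. S j w < S l w} = r})"
        using J by (simp add: sum.If_cases Int_def)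
      finally show ?case using card_rank_eq[OF J elim(1) r] by simp
    qed
  qed (use B in auto)
  finally show ?thesis using r by (simp add: B_def prob_space field_simps)
qed

text \<open>Almost surely, \<open>q w \<le> u\<close> forces \<open>R w \<le> D * (u + a)\<close>,
  and \<open>R w \<le> D * (u - b)\<close> forces \<open>q w \<le> u\<close>. For
  \<open>x \<ge> 0\<close> a uniform rank is at most \<open>x\<close> with probability
  \<open>(floor x + 1) / D\<close>, capped at 1. The rounding costs \<open>1 / D\<close> in the
  upper bound and nothing in the lower one.\<close>

lemma cdf_bounds_of_uniform_rank:
  assumes "prob_space M" and q [measurable]: "q \<in> borel_measurable M"
    and R: "R \<in> measurable M (count_space UNIV)"
    and unif: "\<And>r. r < D \<Longrightarrow> measure M {w \<in> space M. R w = r} = 1 / real D"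
    and D: "0 < D" and lt: "\<And>w. R w < D"
    and bnd: "AE w in M. real (R w) / real D - a \<le> q w \<and> q w \<le> real (R w) / real D + b"
    and ab: "0 \<le> a" "0 \<le> b" and u: "0 \<le> u" "u \<le> 1"
  shows "measure M {w \<in> space M. q w \<le> u} \<le> u + a + 1 / real D"
    and "u - b \<le> measure M {w \<in> space M. q w \<le> u}"
proof -
  interpret prob_space M by fact
  note R [measurable]
  have cdf: "prob {w \<in> space M. R w < k} = real (min k D) / real D" for k
  proof -
    have "{w \<in> space M. R w < k} = (\<Union>r<min k D. {w \<in> space M. R w = r})"
      using lt by auto
    then have "prob {w \<in> space M. R w < k} = (\<Sum>r<min k D. prob {w \<in> space M. R w = r})"
      by (simp only:, intro finite_measure_finite_Union) (auto simp: disjoint_family_on_def)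
    also have "\<dots> = real (min k D) / real D" by (simp add: unif)
    finally show ?thesis .
  qed
  \<comment> \<open>Real thresholds become strict bounds on a natural number, the form in which
    \<open>cdf\<close> is stated.\<close>
  have floor: "R w < nat (\<lfloor>x\<rfloor> + 1) \<longleftrightarrow> real (R w) \<le> x" if "0 \<le> x" for w x
    using that by linarith
  show "prob {w \<in> space M. q w \<le> u} \<le> u + a + 1 / real D"
  proof -
    define x where "x = real D * (u + a)"
    have x: "0 \<le> x" using ab u by (simp add: x_def)
    have le: "real (R w) \<le> x" if "real (R w) / real D - a \<le> q w" "q w \<le> u" for w
    proof -
      have "real (R w) / real D \<le> u + a" using that by linarith
      then show ?thesis using D by (simp add: x_def field_simps)
    qed
    have "prob {w \<in> space M. q w \<le> u} \<le> prob {w \<in> space M. R w < nat (\<lfloor>x\<rfloor> + 1)}"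
    proof (rule finite_measure_mono_AE)
      show "AE w in M. w \<in> {w \<in> space M. q w \<le> u} \<longrightarrow> w \<in> {w \<in> space M. R w < nat (\<lfloor>x\<rfloor> + 1)}"
        using bnd by eventually_elim (use D in \<open>auto simp only: mem_Collect_eq floor[OF x] le\<close>)
    qed measurable
    also have "\<dots> \<le> (x + 1) / real D"
      unfolding cdf using x by (intro divide_right_mono) linarith+
    also have "\<dots> = u + a + 1 / real D" using D by (simp add: x_def field_simps)
    finally show ?thesis .
  qed
  show "u - b \<le> prob {w \<in> space M. q w \<le> u}"
  proof (cases "0 \<le> u - b")
    case True
    define x where "x = real D * (u - b)"
    have x: "0 \<le> x" using True by (simp add: x_def)
    have le: "q w \<le> u" if "q w \<le> real (R w) / real D + b" "real (R w) \<le> x" for w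
    proof -
      have "real (R w) / real D \<le> u - b" using that D by (simp add: x_def field_simps)
      then show ?thesis using that by linarith
    qed
    \<comment> \<open>The threshold \<open>x\<close> must not exceed \<open>D\<close>, since
      \<open>cdf\<close> caps the count of values at \<open>D\<close>.\<close>
    have "u - b \<le> 1" using ab u by simp
    then have "x \<le> real D" using D by (simp add: x_def mult_left_le)
    then have "x \<le> real (min (nat (\<lfloor>x\<rfloor> + 1)) D)" using x by linarith
    then have "u - b \<le> prob {w \<in> space M. R w < nat (\<lfloor>x\<rfloor> + 1)}"
      unfolding cdf using D by (simp add: x_def field_simps)
    also have "\<dots> \<le> prob {w \<in> space M. q w \<le> u}"
    proof (rule finite_measure_mono_AE)
      show "AE w in M. w \<in> {w \<in> space M. R w < nat (\<lfloor>x\<rfloor> + 1)} \<longrightarrow> w \<in> {w \<in> space M. q w \<le> u}"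
        using bnd by eventually_elim (use D in \<open>auto simp only: mem_Collect_eq floor[OF x] le\<close>)
    qed measurable
    finally show ?thesis .
  next
    case False
    then show ?thesis using measure_nonneg[of M "{w \<in> space M. q w \<le> u}"] by linarith
  qed
qed

section \<open>The tail-corrected distribution\<close>

lemma sum_tail_mass_initial:
  assumes "0 < N" "k \<le> N"
  shows "(\<Sum>i=1..k. tail_mass N t i) =
    (real k + (if k = 0 then 0 else t) + (if k = N then 1 - t else 0)) / real (N + 1)"
  using assms
  by (simp add: tail_mass_def sum_divide_distrib[symmetric] sum.distrib)

lemma tail_mass_nonneg: "0 \<le> t \<Longrightarrow> t \<le> 1 \<Longrightarrow> 0 \<le> tail_mass N t i"
  by (simp add: tail_mass_def)

lemma step_level_tail_cpd_0:
  assumes "\<And>i. i \<in> {1..N} \<Longrightarrow> c 1 \<le> c i"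
  shows "step_level (tail_cpd N t c) c 0 = 0"
proof -
  have "Lim (at_left (c 1)) (tail_cpd N t c) = 0"
    using assms by (intro tendsto_Lim tendsto_tail_left) auto
  then show ?thesis by (simp add: step_level_def)
qed

text \<open>The randomized point mass vanishes in the limit, as finitely many atoms leave a gap to
  the right of \<open>c i\<close>. What remains is an explicit function of the atoms, tied or
  not.\<close>

lemma step_level_tail_cpd:
  assumes "0 < i"
  shows "step_level (tail_cpd N t c) c i = tail_measure N t c {..c i}"
proof -
  have "Lim (at_right (c i)) (tail_cpd N t c) = tail_measure N t c {..c i}"
    by (intro tendsto_Lim tendsto_tail_right) simp
  then show ?thesis using assms by (simp add: step_level_def)
qed

text \<open>The correction \<open>t\<close> enters with the first atom and \<open>1 - t\<close> with
  the last. For \<open>t\<close> in the unit interval and \<open>0 < k\<close>, level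
  \<open>k\<close> hence lies between \<open>k / (N + 1)\<close> and
  \<open>(k + 1) / (N + 1)\<close>.\<close>

lemma step_level_tail_cpd_eq:
  assumes c: "strict_mono_on {1..N} c" and N: "0 < N" "k \<le> N"
  shows "step_level (tail_cpd N t c) c k =
    (real k + (if k = 0 then 0 else t) + (if k = N then 1 - t else 0)) / real (N + 1)"
proof -
  have "step_level (tail_cpd N t c) c 0 = 0"
    using strict_mono_on_leD[OF c] N by (intro step_level_tail_cpd_0) auto
  moreover have "(\<Sum>i=1..k. jump_mass (tail_cpd N t c) c i) = (\<Sum>i=1..k. tail_mass N t i)"
    using N by (intro sum.cong jump_mass_tail_cpd[OF c]) auto
  ultimately show ?thesis
    using step_level_eq_sum_jump_mass[of "tail_cpd N t c" c k] sum_tail_mass_initial[OF N, of t]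
    by simp
qed

text \<open>The atoms \<open>c R\<close> and \<open>c (R + 1)\<close> enclose \<open>y\<close>. The
  target at the former is at least \<open>(R - 1/2) / (N + 1)\<close>, the target at the latter at
  most \<open>(R + 3/2) / (N + 1)\<close>, and fidelity adds an error of \<open>\<epsilon>\<close>.
  Where a neighbour is missing, because \<open>R\<close> is \<open>0\<close> or \<open>N\<close>,
  the bounds 0 and 1 of a CDF suffice.\<close>

lemma smoothed_tail_cpd_bounds:
  assumes \<kappa>: "kernel \<kappa>" and h: "0 < h" and c: "strict_mono_on {1..N} c" and N: "0 < N"
    and t: "0 \<le> t" "t \<le> 1" and fid: "fidelity \<kappa> (tail_cpd N t c) c N h \<epsilon>" and \<epsilon>: "0 \<le> \<epsilon>"
    and R: "R \<le> N" "\<And>i. i \<in> {1..N} \<Longrightarrow> c i < y \<longleftrightarrow> i \<le> R"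
  defines "q \<equiv> smoothed_cdf \<kappa> (tail_cpd N t c) c N h y"
  shows "real R / real (N + 1) - (\<epsilon> + 1 / (2 * real (N + 1))) \<le> q"
    and "q \<le> real R / real (N + 1) + (\<epsilon> + 3 / (2 * real (N + 1)))"
proof -
  let ?Q = "tail_cpd N t c"
  have jump: "jump_mass ?Q c i = tail_mass N t i" if "i \<in> {1..N}" for i
    using jump_mass_tail_cpd[OF c that] .
  then have nonneg: "0 \<le> jump_mass ?Q c i" if "i \<in> {1..N}" for i
    using that tail_mass_nonneg[OF t] by simp
  note level = step_level_tail_cpd_eq[OF c N, of _ t]
  define x d where "x = real R / real (N + 1)" and "d = 1 / real (N + 1)"
  have xd: "(real R - 1) / real (N + 1) = x - d" "(real R + 1) / real (N + 1) = x + d"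
    "(real R + 2) / real (N + 1) = x + 2 * d" "1 / (2 * real (N + 1)) = d / 2"
    "3 / (2 * real (N + 1)) = 3 * d / 2"
    by (simp_all add: x_def d_def diff_divide_distrib add_divide_distrib)
  show "real R / real (N + 1) - (\<epsilon> + 1 / (2 * real (N + 1))) \<le> q"
  proof (cases "R = 0")
    case True
    have "0 \<le> q" unfolding q_def by (intro smoothed_cdf_nonneg \<kappa> nonneg)
    moreover have "real R / real (N + 1) = 0" "0 \<le> 1 / (2 * real (N + 1))" using True by simp_all
    ultimately show ?thesis using \<epsilon> by linarith
  next
    case False
    then have "R \<in> {1..N}" using R by auto
    moreover from this have "c R < y" using R by blast
    ultimately have "midpoint_target ?Q c R - \<epsilon> \<le> q"
      unfolding q_def by (intro smoothed_cdf_ge_target \<kappa> h nonneg fid) auto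
    moreover have "(real R - 1) / real (N + 1) \<le> step_level ?Q c (R - 1)"
      using False R t by (subst level) (auto intro!: divide_right_mono)
    moreover have "real R / real (N + 1) \<le> step_level ?Q c R"
      using False R t by (subst level) (auto intro!: divide_right_mono)
    ultimately show ?thesis
      unfolding midpoint_target_def xd x_def[symmetric] unfolding add_divide_distrib by linarith
  qed
  show "q \<le> real R / real (N + 1) + (\<epsilon> + 3 / (2 * real (N + 1)))"
  proof (cases "R = N")
    case True
    have "q \<le> 1"
      unfolding q_def using sum_tail_mass[OF N] jump
      by (intro smoothed_cdf_le_1 \<kappa> nonneg) auto
    moreover have "x + d = 1" "0 \<le> d"
      using True by (simp_all add: x_def d_def add_divide_distrib[symmetric])
    ultimately show ?thesis unfolding xd x_def[symmetric] using \<epsilon> by linarith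
  next
    case False
    then have "R + 1 \<in> {1..N}" using R by auto
    moreover from this have "y \<le> c (R + 1)" using R(2)[of "R + 1"] by auto
    ultimately have "q \<le> midpoint_target ?Q c (R + 1) + \<epsilon>"
      unfolding q_def by (intro smoothed_cdf_le_target \<kappa> h nonneg fid) auto
    moreover have "step_level ?Q c R \<le> (real R + 1) / real (N + 1)"
      using False R t by (subst level) (auto intro!: divide_right_mono)
    moreover have "step_level ?Q c (R + 1) \<le> (real R + 2) / real (N + 1)"
      using False R t by (subst level) (auto intro!: divide_right_mono)
    ultimately show ?thesis
      unfolding midpoint_target_def xd x_def[symmetric] add_diff_cancel_right'
      unfolding add_divide_distrib by linarith
  qed
qed

lemma measurable_smoothed_tail_cpd:
  assumes "kernel \<kappa>" and N: "0 < N"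
    and f: "\<And>i. i \<in> {1..N} \<Longrightarrow> (\<lambda>w. f w i) \<in> borel_measurable M"
    and [measurable]: "\<tau> \<in> borel_measurable M" "h \<in> borel_measurable M" "y \<in> borel_measurable M"
  shows "(\<lambda>w. smoothed_cdf \<kappa> (tail_cpd N (\<tau> w) (order_stat N (f w))) (order_stat N (f w)) N (h w) (y w))
    \<in> borel_measurable M"
proof (rule measurable_smoothed_cdf[OF assms(1)])
  let ?c = "\<lambda>w. order_stat N (f w)"
  show c: "(\<lambda>w. ?c w i) \<in> borel_measurable M" if "i \<in> {1..N}" for i
    using f that by (rule measurable_order_stat)
  fix i assume i: "i \<in> {0..N}"
  show "(\<lambda>w. step_level (tail_cpd N (\<tau> w) (?c w)) (?c w) i) \<in> borel_measurable M"
  proof (cases "i = 0")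
    case True
    have "step_level (tail_cpd N (\<tau> w) (?c w)) (?c w) 0 = 0" for w
      by (intro step_level_tail_cpd_0 order_stat_mono) auto
    then show ?thesis using True by simp
  next
    case False
    have "(\<lambda>w. \<Sum>j=1..N. tail_mass N (\<tau> w) j * indicator {..?c w i} (?c w j)) \<in> borel_measurable M"
    proof (rule borel_measurable_sum)
      fix j assume j: "j \<in> {1..N}"
      have [measurable]: "(\<lambda>w. ?c w i) \<in> borel_measurable M" "(\<lambda>w. ?c w j) \<in> borel_measurable M"
        using c i j False by auto
      \<comment> \<open>The indicator of a set that moves with \<open>w\<close> is replaced by the
        truth value of a measurable comparison.\<close>
      have "(\<lambda>w. tail_mass N (\<tau> w) j * of_bool (?c w j \<le> ?c w i)) \<in> borel_measurable M"
        unfolding tail_mass_def of_bool_def by measurable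
      then show "(\<lambda>w. tail_mass N (\<tau> w) j * indicator {..?c w i} (?c w j)) \<in> borel_measurable M"
        by (simp add: indicator_def)
    qed
    then show ?thesis using False by (simp add: step_level_tail_cpd tail_measure_def)
  qed
qed fact+

section \<open>The quantile-matched distribution\<close>

text \<open>The worst case is \<open>k = K - 1\<close>, where
  \<open>(N + 1) * (K - 1) \<le> N * K\<close> amounts to \<open>K \<le> N + 1\<close>. Rounding up
  therefore stays within the \<open>N\<close> order statistics.\<close>

lemma qm_index_le:
  assumes "0 < k" "k < K" "K < N + 1"
  shows "nat \<lceil>real (N + 1) * alpha K k\<rceil> \<in> {1..N}"
proof -
  have "(N + 1) * k \<le> N * K"
  proof -
    have "(N + 1) * k \<le> (N + 1) * (K - 1)" using assms by (intro mult_left_mono) auto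
    also have "\<dots> \<le> N * K" using assms by (cases K) (auto simp: algebra_simps)
    finally show ?thesis .
  qed
  then have "real (N + 1) * real k \<le> real N * real K" by (metis of_nat_le_iff of_nat_mult)
  then have "real (N + 1) * alpha K k \<le> real N"
    using assms by (simp add: alpha_def field_simps)
  moreover have "0 < real (N + 1) * alpha K k" using assms by (simp add: alpha_def)
  ultimately have "0 < \<lceil>real (N + 1) * alpha K k\<rceil>" "\<lceil>real (N + 1) * alpha K k\<rceil> \<le> int N"
    by (simp_all only: zero_less_ceiling ceiling_le_iff of_int_of_nat_eq)
  then show ?thesis by (simp only: atLeastAtMost_iff) linarith
qed

lemma step_level_qm_cdf_0: "step_level (qm_cdf N K a) (qm_step_atom N K a) 0 = 0"
proof -
  have "(qm_cdf N K a \<longlongrightarrow> 0) (at_left (a 1))"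
    by (intro tendsto_eventually)
      (auto simp: eventually_at_left_field qm_cdf_def intro!: exI[of _ "a 1 - 1"])
  then have "Lim (at_left (a 1)) (qm_cdf N K a) = 0" by (intro tendsto_Lim) auto
  then show ?thesis by (simp add: step_level_def qm_step_atom_def)
qed

lemma eventually_at_right_less_iff:
  fixes x :: real
  shows "\<forall>\<^sub>F y in at_right x. ereal y < e \<longleftrightarrow> ereal x < e"
proof (cases "ereal x < e")
  case True
  then obtain b where "ereal x < ereal b" "ereal b < e" using ereal_dense2 by blast
  then have "x < b \<and> (\<forall>y>x. y < b \<longrightarrow> ereal y < e)"
    by (auto intro: less_trans[of "ereal _" "ereal b"])
  then show ?thesis using True by (auto simp: eventually_at_right_field)
next
  case False
  then have "\<not> ereal y < e" if "x < y" for y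
    using that by (meson less_ereal.simps(1) less_trans)
  then show ?thesis using False by (auto simp: eventually_at_right_field intro!: exI[of _ "x + 1"])
qed

text \<open>The value at \<open>y\<close> depends on finitely many strict comparisons of
  \<open>y\<close> with thresholds, and each keeps its truth value just to the right of a point. The
  function is thus right-continuous, whether or not the values \<open>a\<close> are tied.\<close>

lemma step_level_qm_cdf:
  assumes "0 < i"
  shows "step_level (qm_cdf N K a) c i = qm_cdf N K a (c i)"
proof -
  let ?x = "c i"
  have "\<forall>\<^sub>F y in at_right ?x. \<forall>j\<in>{..K}. ereal y < qm_quantile N K a j \<longleftrightarrow> ereal ?x < qm_quantile N K a j"
    by (intro eventually_ball_finite ballI eventually_at_right_less_iff) simp
  moreover have "\<forall>\<^sub>F y in at_right ?x. ereal y < a 1 \<longleftrightarrow> ereal ?x < a 1"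
    by (rule eventually_at_right_less_iff)
  ultimately have "\<forall>\<^sub>F y in at_right ?x. qm_cdf N K a y = qm_cdf N K a ?x"
  proof eventually_elim
    case (elim y)
    then have "{alpha K j | j. j \<le> K \<and> ereal y < qm_quantile N K a j} =
        {alpha K j | j. j \<le> K \<and> ereal ?x < qm_quantile N K a j}" by auto
    then show ?case using elim(2) by (auto simp: qm_cdf_def not_less[symmetric])
  qed
  then have "Lim (at_right ?x) (qm_cdf N K a) = qm_cdf N K a ?x"
    by (intro tendsto_Lim tendsto_eventually) auto
  then show ?thesis using assms by (simp add: step_level_def)
qed

lemma step_level_qm_cdf_eq:
  assumes a: "strict_mono_on {1..N} a" and K: "0 < K" "K < N + 1" and k: "k \<le> K"
  shows "step_level (qm_cdf N K a) (qm_step_atom N K a) k = real k / real K"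
proof -
  have "(\<Sum>i=1..k. jump_mass (qm_cdf N K a) (qm_step_atom N K a) i) = (\<Sum>i=1..k. 1 / real K)"
    using k by (intro sum.cong jump_mass_qm_cdf[OF a K]) auto
  then show ?thesis
    using step_level_eq_sum_jump_mass[of "qm_cdf N K a" "qm_step_atom N K a" k]
    by (simp add: step_level_qm_cdf_0)
qed

text \<open>The infimum is attained, as index \<open>K\<close> always qualifies and
  \<open>alpha K\<close> is monotone. This form is for measurability: the least index satisfying
  measurable conditions is measurable.\<close>

lemma qm_cdf_eq_Least:
  assumes "0 < K"
  shows "qm_cdf N K a y =
    (if a 1 \<le> y then alpha K (LEAST j. j \<le> K \<and> ereal y < qm_quantile N K a j) else 0)"
proof -
  let ?P = "\<lambda>j. j \<le> K \<and> ereal y < qm_quantile N K a j"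
  have "?P K" using assms by (simp add: qm_quantile_def)
  then have "?P (LEAST j. ?P j)" by (rule LeastI)
  moreover have "alpha K (LEAST j. ?P j) \<le> alpha K j" if "?P j" for j
    using Least_le[of ?P, OF that] by (simp add: alpha_def divide_right_mono)
  ultimately have "Inf {alpha K j | j. ?P j} = alpha K (LEAST j. ?P j)"
    by (intro cInf_eq_minimum) blast+
  then show ?thesis by (simp add: qm_cdf_def)
qed

lemma qm_step_atom_eq:
  "i \<in> {1..K} \<Longrightarrow>
    qm_step_atom N K a i = a (if i = 1 then 1 else nat \<lceil>real (N + 1) * alpha K (i - 1)\<rceil>)"
  by (auto simp: qm_step_atom_def qm_quantile_def)

lemma measurable_smoothed_qm_cdf:
  assumes "kernel \<kappa>" and K: "0 < K" "K < N + 1"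
    and a: "\<And>i. i \<in> {1..N} \<Longrightarrow> (\<lambda>w. a w i) \<in> borel_measurable M"
    and "h \<in> borel_measurable M" "y \<in> borel_measurable M"
  shows "(\<lambda>w. smoothed_cdf \<kappa> (qm_cdf N K (a w)) (qm_step_atom N K (a w)) K (h w) (y w))
    \<in> borel_measurable M"
proof (rule measurable_smoothed_cdf[OF assms(1)])
  show c: "(\<lambda>w. qm_step_atom N K (a w) i) \<in> borel_measurable M" if i: "i \<in> {1..K}" for i
  proof -
    have "(if i = 1 then 1 else nat \<lceil>real (N + 1) * alpha K (i - 1)\<rceil>) \<in> {1..N}"
      using i K qm_index_le[of "i - 1" K N] by auto
    then show ?thesis unfolding qm_step_atom_eq[OF i] by (rule a)
  qed
  fix i assume i: "i \<in> {0..K}"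
  show "(\<lambda>w. step_level (qm_cdf N K (a w)) (qm_step_atom N K (a w)) i) \<in> borel_measurable M"
  proof (cases "i = 0")
    case True
    then show ?thesis by (simp add: step_level_qm_cdf_0)
  next
    case False
    then have [measurable]: "(\<lambda>w. qm_step_atom N K (a w) i) \<in> borel_measurable M"
      using i by (intro c) auto
    have [measurable]: "(\<lambda>w. a w 1) \<in> borel_measurable M" using K by (intro a) auto
    have pred: "Measurable.pred M
        (\<lambda>w. j \<le> K \<and> ereal (qm_step_atom N K (a w) i) < qm_quantile N K (a w) j)" for j
    proof -
      \<comment> \<open>The condition depends on \<open>w\<close> only for \<open>j\<close> strictly
        between \<open>0\<close> and \<open>K\<close>; otherwise \<open>j\<close> exceeds
        \<open>K\<close> or the quantile is infinite.\<close>
      consider "j = 0" | "j = K" | "K < j" | "0 < j" "j < K" by linarith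
      then show ?thesis
      proof cases
        case 4
        then have [measurable]: "(\<lambda>w. a w (nat \<lceil>real (N + 1) * alpha K j\<rceil>)) \<in> borel_measurable M"
          using qm_index_le[of j K N] K by (intro a) auto
        have "Measurable.pred M (\<lambda>w. qm_step_atom N K (a w) i < a w (nat \<lceil>real (N + 1) * alpha K j\<rceil>))"
          by measurable
        then show ?thesis using 4 by (simp add: qm_quantile_def)
      qed (use K in \<open>auto simp: qm_quantile_def\<close>)
    qed
    have "(\<lambda>w. qm_cdf N K (a w) (qm_step_atom N K (a w) i)) \<in> borel_measurable M"
      unfolding qm_cdf_eq_Least[OF K(1)]
    proof (rule measurable_If)
      show "(\<lambda>w. alpha K (LEAST j. j \<le> K \<and> ereal (qm_step_atom N K (a w) i) < qm_quantile N K (a w) j))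
          \<in> borel_measurable M"
        by (rule measurable_compose[OF measurable_Least[OF pred]]) simp
    qed measurable
    then show ?thesis using False by (simp add: step_level_qm_cdf)
  qed
qed fact+

text \<open>The target at the \<open>i\<close>-th atom is \<open>(i - 1/2) / K\<close>. With
  \<open>s\<close> the integer part of \<open>R * K / (N + 1)\<close>, exactly the first
  \<open>s + 1\<close> atoms lie below \<open>y\<close> if \<open>R > 0\<close>, and none if
  \<open>R = 0\<close>. As \<open>s / K\<close> falls short of \<open>R / (N + 1)\<close> by less
  than \<open>1 / K\<close>, the neighbours of \<open>y\<close> give both bounds.\<close>

lemma smoothed_qm_cdf_bounds:
  assumes \<kappa>: "kernel \<kappa>" and h: "0 < h" and a: "strict_mono_on {1..N} a" and K: "0 < K" "K < N + 1"
    and fid: "fidelity \<kappa> (qm_cdf N K a) (qm_step_atom N K a) K h \<epsilon>" and \<epsilon>: "0 \<le> \<epsilon>"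
    and R: "R \<le> N" "\<And>i. i \<in> {1..N} \<Longrightarrow> a i < y \<longleftrightarrow> i \<le> R"
  defines "q \<equiv> smoothed_cdf \<kappa> (qm_cdf N K a) (qm_step_atom N K a) K h y"
  shows "real R / real (N + 1) - (\<epsilon> + 1 / (2 * real K)) \<le> q"
    and "q \<le> real R / real (N + 1) + (\<epsilon> + 3 / (2 * real K))"
proof -
  let ?Q = "qm_cdf N K a" and ?c = "qm_step_atom N K a"
  have jump: "jump_mass ?Q ?c i = 1 / real K" if "i \<in> {1..K}" for i
    using jump_mass_qm_cdf[OF a K that] .
  then have nonneg: "0 \<le> jump_mass ?Q ?c i" if "i \<in> {1..K}" for i
    using that by simp
  have target: "midpoint_target ?Q ?c i = real i / real K - 1 / (2 * real K)" if "i \<in> {1..K}" for i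
  proof -
    have "step_level ?Q ?c i = real i / real K" "step_level ?Q ?c (i - 1) = real (i - 1) / real K"
      using that by (intro step_level_qm_cdf_eq[OF a K]; auto)+
    moreover have "real (i - 1) = real i - 1" using that by auto
    ultimately show ?thesis
      by (simp only: midpoint_target_def diff_divide_distrib) (simp add: field_simps)
  qed
  \<comment> \<open>The first atom \<open>a 1\<close> is below \<open>y\<close> as soon as
    \<open>R > 0\<close>. A later one is the order statistic whose index is
    \<open>(N + 1) * (i - 1) / K\<close> rounded up, and that index is at most \<open>R\<close> iff
    the unrounded quotient is.\<close>
  have below: "?c i < y \<longleftrightarrow> 0 < R \<and> (i - 1) * (N + 1) \<le> R * K" if i: "i \<in> {1..K}" for i
  proof (cases "i = 1")
    case True
    then show ?thesis using R(2)[of 1] K i by (auto simp: qm_step_atom_def)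
  next
    case False
    let ?l = "nat \<lceil>real (N + 1) * alpha K (i - 1)\<rceil>"
    have l: "?l \<in> {1..N}" using i False K by (intro qm_index_le) auto
    have atom: "?c i < y \<longleftrightarrow> ?l \<le> R" using R(2)[OF l] False by (simp add: qm_step_atom_eq[OF i])
    have pos: "0 < R" if "?l \<le> R" using that l by (simp only: atLeastAtMost_iff) linarith
    have "?l \<le> R \<longleftrightarrow> real (N + 1) * alpha K (i - 1) \<le> real R" by linarith
    also have "\<dots> \<longleftrightarrow> real (i - 1) * real (N + 1) \<le> real R * real K"
      using K by (simp add: alpha_def field_simps)
    also have "\<dots> \<longleftrightarrow> (i - 1) * (N + 1) \<le> R * K" by (metis of_nat_le_iff of_nat_mult)
    finally show ?thesis using atom pos by blast
  qed
  define s where "s = R * K div (N + 1)"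
  have s_le: "s * (N + 1) \<le> R * K" unfolding s_def by (rule div_times_less_eq_dividend)
  have s_gt: "R * K < (s + 1) * (N + 1)" unfolding s_def using dividend_less_div_times[of "N + 1" "R * K"] by simp
  have s_real: "real s / real K \<le> real R / real (N + 1)" "real R / real (N + 1) < (real s + 1) / real K"
  proof -
    have "real (s * (N + 1)) \<le> real (R * K)" "real (R * K) < real ((s + 1) * (N + 1))"
      using s_le s_gt by (simp_all only: of_nat_le_iff of_nat_less_iff)
    then show "real s / real K \<le> real R / real (N + 1)" "real R / real (N + 1) < (real s + 1) / real K"
      using K by (simp_all add: field_simps)
  qed
  \<comment> \<open>This rests on \<open>R \<le> N\<close> and ensures that atom
    \<open>s + 1\<close> exists.\<close>
  have sK: "s < K"
  proof -
    have "R * K < (N + 1) * K" using R K by (intro mult_strict_right_mono) auto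
    then have "R * K < K * (N + 1)" by (simp only: mult.commute)
    then show ?thesis unfolding s_def by (simp add: div_less_iff_less_mult)
  qed
  show "real R / real (N + 1) - (\<epsilon> + 1 / (2 * real K)) \<le> q"
  proof (cases "R = 0")
    case True
    have "0 \<le> q" unfolding q_def by (intro smoothed_cdf_nonneg \<kappa> nonneg)
    moreover have "real R / real (N + 1) = 0" "0 \<le> 1 / (2 * real K)" using True by simp_all
    ultimately show ?thesis using \<epsilon> by linarith
  next
    case False
    have i: "s + 1 \<in> {1..K}" using sK by auto
    have "?c (s + 1) < y" using below[OF i] False s_le by simp
    then have "midpoint_target ?Q ?c (s + 1) - \<epsilon> \<le> q"
      unfolding q_def using i by (intro smoothed_cdf_ge_target \<kappa> h nonneg fid) auto
    then have "(real s + 1) / real K - 1 / (2 * real K) - \<epsilon> \<le> q"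
      unfolding target[OF i] by (simp add: add.commute)
    then show ?thesis using s_real(2) by linarith
  qed
  \<comment> \<open>\<open>u\<close> is the index of the first atom not below \<open>y\<close>,
    where \<open>K + 1\<close> stands for none; in that case \<open>q \<le> 1\<close> takes the
    place of fidelity.\<close>
  define u where "u = (if R = 0 then 1 else s + 2)"
  define x d where "x = real R / real (N + 1)" and "d = 1 / real K"
  have xd: "real i / real K = real i * d" "1 / (2 * real K) = d / 2" "3 / (2 * real K) = 3 * d / 2" for i
    by (simp_all add: d_def)
  have "0 \<le> x" "0 \<le> d" "real s * d \<le> x" using s_real(1) by (simp_all add: x_def d_def)
  then have u_le: "real u * d \<le> x + 2 * d" by (simp add: u_def distrib_right)
  show "q \<le> real R / real (N + 1) + (\<epsilon> + 3 / (2 * real K))"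
  proof (cases "u \<le> K")
    case True
    then have i: "u \<in> {1..K}" by (auto simp: u_def)
    have "\<not> ?c u < y" unfolding below[OF i] using s_gt by (auto simp: u_def)
    then have "q \<le> midpoint_target ?Q ?c u + \<epsilon>"
      unfolding q_def using i by (intro smoothed_cdf_le_target \<kappa> h nonneg fid) auto
    then show ?thesis
      unfolding target[OF i] xd x_def[symmetric] using u_le by linarith
  next
    case False
    then have "u = K + 1" using K sK by (auto simp: u_def split: if_splits)
    then have "real u * d = 1 + d" using K by (simp add: d_def field_simps)
    moreover have "q \<le> 1"
      unfolding q_def using jump K by (intro smoothed_cdf_le_1 \<kappa> nonneg) auto
    ultimately show ?thesis
      unfolding xd x_def[symmetric] using u_le \<open>0 \<le> d\<close> \<epsilon> by linarith
  qed
qed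

section \<open>Validity of the smoothed distributions\<close>

text \<open>Observations carry the Borel sigma-algebra of the product type, so the projections are
  measurable by continuity.\<close>

lemma borel_measurable_fst: "fst \<in> borel_measurable borel"
  and borel_measurable_snd: "snd \<in> borel_measurable borel"
  by (intro borel_measurable_continuous_onI continuous_intros)+

text \<open>Common end of both halves: the rank of the test score is uniform. The deviation above is
  at most \<open>a + 1 / (n - m + 1)\<close> and the one below at most \<open>b\<close>, so
  \<open>c\<close> has to dominate each of them but not their sum.\<close>

lemma smoothed_validity_of_rank_bounds:
  fixes S :: "nat \<Rightarrow> 'w \<Rightarrow> real"
  assumes "prob_space M" and mn: "m < n" and ex: "exchangeable M {m + 1..n + 1} S"
    and inj: "AE w in M. inj_on (\<lambda>j. S j w) {m + 1..n + 1}"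
    and q: "q \<in> borel_measurable M"
    and bnd: "AE w in M. \<forall>R. R = card {i\<in>{1..n - m}. S (m + i) w < S (n + 1) w} \<longrightarrow>
      real R / real (n - m + 1) - a \<le> q w \<and> q w \<le> real R / real (n - m + 1) + b"
    and ab: "0 \<le> a" "0 \<le> b" and c: "a + 1 / real (n - m + 1) \<le> c" "b \<le> c"
  shows "(SUP u\<in>{0..1}. \<bar>measure M {w \<in> space M. q w \<le> u} - u\<bar>) \<le> c"
proof (rule cSUP_least)
  fix u :: real assume u: "u \<in> {0..1}"
  let ?J = "{m + 1..n + 1}"
  define R where "R w = card {j\<in>?J. S j w < S (n + 1) w}" for w
  have S: "S j \<in> borel_measurable M" if "j \<in> ?J" for j
    using ex that by (auto simp: exchangeable_def)
  have J: "card ?J = n - m + 1" "n + 1 \<in> ?J" using mn by auto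
  \<comment> \<open>\<open>?J\<close> also contains the test index, but no score is below itself, so
    the shift by \<open>m\<close> is a bijection between the counted sets.\<close>
  have R_eq: "card {i\<in>{1..n - m}. S (m + i) w < S (n + 1) w} = R w" for w
    unfolding R_def
    by (rule bij_betw_same_card[where f = "\<lambda>i. m + i"], rule bij_betwI[where g = "\<lambda>j. j - m"])
      (auto simp: le_Suc_eq)
  have R: "R \<in> measurable M (count_space UNIV)"
    unfolding R_def using S J by (intro measurable_rank) auto
  have unif: "measure M {w \<in> space M. R w = r} = 1 / real (n - m + 1)" if "r < n - m + 1" for r
    using exchangeable_rank_uniform[OF assms(1) ex _ inj J(2), of r] that
    unfolding R_def J(1) by simp
  have lt: "R w < n - m + 1" for w
  proof -
    have "n + 1 \<notin> {j\<in>?J. S j w < S (n + 1) w}" by simp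
    then have "{j\<in>?J. S j w < S (n + 1) w} \<subset> ?J" using J(2) by blast
    then have "R w < card ?J" unfolding R_def by (intro psubset_card_mono) simp
    then show ?thesis unfolding J(1) .
  qed
  have bnd': "AE w in M. real (R w) / real (n - m + 1) - a \<le> q w \<and> q w \<le> real (R w) / real (n - m + 1) + b"
    using bnd
  proof eventually_elim
    case (elim w)
    show ?case using elim[rule_format, OF R_eq[symmetric]] .
  qed
  have "measure M {w \<in> space M. q w \<le> u} \<le> u + a + 1 / real (n - m + 1)"
    "u - b \<le> measure M {w \<in> space M. q w \<le> u}"
    using cdf_bounds_of_uniform_rank[OF assms(1) q R unif _ lt bnd' ab] u by auto
  then show "\<bar>measure M {w \<in> space M. q w \<le> u} - u\<bar> \<le> c" using c by linarith
qed simp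

lemma (in prob_space) AE_unit_interval_of_uniform:
  assumes "\<tau> \<in> borel_measurable M" "distr M borel \<tau> = uniform_measure lborel {0..1 :: real}"
  shows "AE w in M. 0 \<le> \<tau> w \<and> \<tau> w \<le> 1"
proof -
  have "AE x in uniform_measure lborel {0..1 :: real}. 0 \<le> x \<and> x \<le> 1"
    by (intro AE_uniform_measureI) auto
  then show ?thesis unfolding assms(2)[symmetric] using assms(1) by (subst (asm) AE_distr_iff) auto
qed

text \<open>Adding the prediction at the test point turns calibration residuals into the values
  \<open>A_i\<close> and the test residual into the test response. Ranks and distinctness thus pass
  from the residuals to the values \<open>A_i\<close>.\<close>

lemma qm_validity:
  fixes Z :: "nat \<Rightarrow> 'w \<Rightarrow> (real ^ 'p::finite) \<times> real"
  assumes "prob_space M" and mn: "m < n" and ex: "exchangeable M {1..n + 1} Z"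
    and \<kappa>: "kernel \<kappa>" and \<epsilon>: "0 < \<epsilon>"
    and f: "(\<lambda>(z, x). f z x) \<in> borel_measurable ((\<Pi>\<^sub>M i\<in>{1..m}. borel) \<Otimes>\<^sub>M borel)"
    and inj: "AE w in M. inj_on (residual m f (\<lambda>j. Z j w)) {m + 1..n + 1}"
    and K: "0 < K" "K < n - m + 1" and h: "h \<in> borel_measurable M"
    and fid: "AE w in M. 0 < h w \<and>
      fidelity \<kappa> (qm m n K f (\<lambda>j. Z j w)) (qm_atom m n K f (\<lambda>j. Z j w)) K (h w) \<epsilon>"
  shows "(SUP u\<in>{0..1}. \<bar>measure M {w \<in> space M. smoothed_cdf \<kappa> (qm m n K f (\<lambda>j. Z j w))
      (qm_atom m n K f (\<lambda>j. Z j w)) K (h w) (snd (Z (n + 1) w)) \<le> u} - u\<bar>)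
    \<le> \<epsilon> + 3 / (2 * real K) + 1 / real (n - m + 1)"
proof -
  let ?N = "n - m"
  define S where "S j w = residual m f (\<lambda>j. Z j w) j" for j w
  let ?y = "\<lambda>w. snd (Z (n + 1) w)"
  let ?v = "\<lambda>w. qm_value m n f (\<lambda>j. Z j w)"
  have Sex: "exchangeable M {m + 1..n + 1} S"
  proof -
    have "(\<lambda>p. snd (snd p) - (case (fst p, fst (snd p)) of (z, x) \<Rightarrow> f z x)) \<in>
        borel_measurable ((\<Pi>\<^sub>M i\<in>{1..m}. borel :: ((real ^ 'p) \<times> real) measure) \<Otimes>\<^sub>M borel)"
    proof (rule borel_measurable_diff)
      show "(\<lambda>p. snd (snd p)) \<in> borel_measurable ((\<Pi>\<^sub>M i\<in>{1..m}. borel :: ((real ^ 'p) \<times> real) measure) \<Otimes>\<^sub>M (borel :: ((real ^ 'p) \<times> real) measure))"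
        by (rule measurable_compose[OF measurable_snd borel_measurable_snd])
      show "(\<lambda>p. case (fst p, fst (snd p)) of (z, x) \<Rightarrow> f z x) \<in>
          borel_measurable ((\<Pi>\<^sub>M i\<in>{1..m}. borel :: ((real ^ 'p) \<times> real) measure) \<Otimes>\<^sub>M borel)"
        by (rule measurable_compose[OF measurable_Pair f], rule measurable_fst,
          rule measurable_compose[OF measurable_snd borel_measurable_fst])
    qed
    then have "(\<lambda>(z, a). snd a - f z (fst a)) \<in> borel_measurable ((\<Pi>\<^sub>M i\<in>{1..m}. borel) \<Otimes>\<^sub>M borel)"
      by (simp add: case_prod_beta')
    moreover have "{1..m} \<inter> {m + 1..n + 1} = {}" "{1..m} \<union> {m + 1..n + 1} \<subseteq> {1..n + 1}"
      using mn by auto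
    ultimately show ?thesis
      using exchangeable_scores[OF ex, of "{1..m}" "{m + 1..n + 1}"]
      by (simp add: S_def[abs_def] residual_def training_def)
  qed
  then have S: "S j \<in> borel_measurable M" if "j \<in> {m + 1..n + 1}" for j
    using that by (auto simp: exchangeable_def)
  have y [measurable]: "?y \<in> borel_measurable M"
    using ex by (intro measurable_compose[OF _ borel_measurable_snd]) (auto simp: exchangeable_def)
  \<comment> \<open>The prediction at the test point is written as response minus residual, so that
    measurability follows from that of the scores.\<close>
  have v_eq: "?v w i = ?y w - S (n + 1) w + S (m + i) w" for w i
    by (simp add: qm_value_def S_def residual_def)
  have v: "(\<lambda>w. ?v w i) \<in> borel_measurable M" if "i \<in> {1..?N}" for i
  proof -
    have [measurable]: "S (n + 1) \<in> borel_measurable M" "S (m + i) \<in> borel_measurable M"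
      using that mn by (auto intro!: S)
    show ?thesis unfolding v_eq by measurable
  qed
  show ?thesis
  proof (rule smoothed_validity_of_rank_bounds[OF assms(1) mn Sex,
      where a = "\<epsilon> + 1 / (2 * real K)" and b = "\<epsilon> + 3 / (2 * real K)"])
    show "AE w in M. inj_on (\<lambda>j. S j w) {m + 1..n + 1}" using inj by (simp add: S_def)
    show "(\<lambda>w. smoothed_cdf \<kappa> (qm m n K f (\<lambda>j. Z j w)) (qm_atom m n K f (\<lambda>j. Z j w)) K (h w) (?y w))
        \<in> borel_measurable M"
      unfolding qm_def qm_atom_def
      by (intro measurable_smoothed_qm_cdf \<kappa> K h y measurable_order_stat v) (use K in auto)
    show "AE w in M. \<forall>R. R = card {i\<in>{1..?N}. S (m + i) w < S (n + 1) w} \<longrightarrow>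
        real R / real (?N + 1) - (\<epsilon> + 1 / (2 * real K)) \<le>
          smoothed_cdf \<kappa> (qm m n K f (\<lambda>j. Z j w)) (qm_atom m n K f (\<lambda>j. Z j w)) K (h w) (?y w) \<and>
        smoothed_cdf \<kappa> (qm m n K f (\<lambda>j. Z j w)) (qm_atom m n K f (\<lambda>j. Z j w)) K (h w) (?y w) \<le>
          real R / real (?N + 1) + (\<epsilon> + 3 / (2 * real K))"
      using inj fid
    proof eventually_elim
      case (elim w)
      define R where "R = card {i\<in>{1..?N}. S (m + i) w < S (n + 1) w}"
      have R_eq: "card {i\<in>{1..?N}. ?v w i < ?y w} = R"
        unfolding R_def by (rule arg_cong[where f = card]) (auto simp: v_eq)
      have R_le: "R \<le> ?N"
        unfolding R_def by (rule order.trans[OF card_mono[of "{1..?N}"]]) auto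
      have "inj_on (?v w) {1..?N}"
      proof (rule inj_onI)
        fix i j assume ij: "i \<in> {1..?N}" "j \<in> {1..?N}" "?v w i = ?v w j"
        then have "S (m + i) w = S (m + j) w" by (simp add: v_eq)
        then have "m + i = m + j"
          using ij mn unfolding S_def by (intro inj_onD[OF elim(1)]) auto
        then show "i = j" by simp
      qed
      then have a: "strict_mono_on {1..?N} (order_stat ?N (?v w))"
        by (rule order_stat_strict_mono)
      have less: "order_stat ?N (?v w) i < ?y w \<longleftrightarrow> i \<le> R" if "i \<in> {1..?N}" for i
        using order_stat_less_iff[OF that, of "?v w" "?y w"] unfolding R_eq .
      show ?case
        using smoothed_qm_cdf_bounds[OF \<kappa> _ a K _ less_imp_le[OF \<epsilon>] R_le less] elim(2)
        by (simp add: qm_def qm_atom_def R_def)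
    qed
    show "\<epsilon> + 1 / (2 * real K) + 1 / real (?N + 1) \<le> \<epsilon> + 3 / (2 * real K) + 1 / real (?N + 1)"
      by (simp add: divide_right_mono)
  qed (use \<epsilon> in auto)
qed

text \<open>The atom equations place all scores on one monotone curve, that of \<open>E\<close> at
  the test covariate, so the rank of the test score counts the atoms below the test response. The
  bound is free of \<open>\<tau>\<close>.\<close>

lemma cpd_validity:
  fixes Z :: "nat \<Rightarrow> 'w \<Rightarrow> (real ^ 'p::finite) \<times> real"
  assumes "prob_space M" and mn: "m < n" and ex: "exchangeable M {1..n + 1} Z"
    and \<kappa>: "kernel \<kappa>" and \<epsilon>: "0 < \<epsilon>"
    and E: "conformity_measure m E"
    and C: "\<And>i. i \<in> {1..n - m} \<Longrightarrow> (\<lambda>w. conformal_atom m n E sol (\<lambda>j. Z j w) i) \<in> borel_measurable M"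
    and sol: "AE w in M. solves_atom_equations m n E sol (\<lambda>j. Z j w)"
    and inj: "AE w in M. inj_on (conformal_atom m n E sol (\<lambda>j. Z j w)) {1..n - m}"
    and \<tau>: "\<tau> \<in> borel_measurable M" "AE w in M. 0 \<le> \<tau> w \<and> \<tau> w \<le> 1"
    and h: "h \<in> borel_measurable M"
    and fid: "AE w in M. 0 < h w \<and>
      fidelity \<kappa> (cpd m n E sol (\<tau> w) (\<lambda>j. Z j w)) (cpd_atom m n E sol (\<lambda>j. Z j w)) (n - m) (h w) \<epsilon>"
    and N: "2 \<le> n - m"
  shows "(SUP u\<in>{0..1}. \<bar>measure M {w \<in> space M. smoothed_cdf \<kappa> (cpd m n E sol (\<tau> w) (\<lambda>j. Z j w))
      (cpd_atom m n E sol (\<lambda>j. Z j w)) (n - m) (h w) (snd (Z (n + 1) w)) \<le> u} - u\<bar>)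
    \<le> \<epsilon> + 3 / (2 * real (n - m + 1))"
proof -
  let ?N = "n - m"
  define S where "S j w = E (training m (\<lambda>j. Z j w)) (Z j w)" for j w
  let ?y = "\<lambda>w. snd (Z (n + 1) w)"
  let ?C = "\<lambda>w. conformal_atom m n E sol (\<lambda>j. Z j w)"
  have E_meas: "(\<lambda>(z, a). E z a) \<in> borel_measurable ((\<Pi>\<^sub>M i\<in>{1..m}. borel) \<Otimes>\<^sub>M borel)"
    using E by (simp add: conformity_measure_def)
  have "{1..m} \<inter> {m + 1..n + 1} = {}" "{1..m} \<union> {m + 1..n + 1} \<subseteq> {1..n + 1}"
    using mn by auto
  then have Sex: "exchangeable M {m + 1..n + 1} S"
    using exchangeable_scores[OF ex _ _ E_meas, of "{m + 1..n + 1}"]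
    by (simp add: S_def[abs_def] training_def)
  have y: "?y \<in> borel_measurable M"
    using ex by (intro measurable_compose[OF _ borel_measurable_snd]) (auto simp: exchangeable_def)
  txt \<open>Equal scores among the calibration points would give equal atoms, and by exchangeability
    the test point ties with a calibration point no more often than two calibration points do.\<close>
  have inj_S: "AE w in M. inj_on (\<lambda>j. S j w) {m + 1..n + 1}"
  proof (rule exchangeable_AE_inj[OF assms(1) Sex])
    show "AE w in M. S (m + 1) w \<noteq> S (m + 2) w"
      using inj
    proof eventually_elim
      case (elim w)
      show ?case
      proof
        assume "S (m + 1) w = S (m + 2) w"
        then have "?C w 1 = ?C w 2"
          by (simp add: conformal_atom_def conf_score_def S_def)
        then show False using inj_onD[OF elim, of 1 2] N by simp
      qed
    qed
  qed (use N in auto)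
  show ?thesis
  proof (rule smoothed_validity_of_rank_bounds[OF assms(1) mn Sex inj_S,
      where a = "\<epsilon> + 1 / (2 * real (?N + 1))" and b = "\<epsilon> + 3 / (2 * real (?N + 1))"])
    show "(\<lambda>w. smoothed_cdf \<kappa> (cpd m n E sol (\<tau> w) (\<lambda>j. Z j w))
        (cpd_atom m n E sol (\<lambda>j. Z j w)) ?N (h w) (?y w)) \<in> borel_measurable M"
      unfolding cpd_def cpd_atom_def
      by (intro measurable_smoothed_tail_cpd \<kappa> C \<tau>(1) h y) (use mn in auto)
    show "AE w in M. \<forall>R. R = card {i\<in>{1..?N}. S (m + i) w < S (n + 1) w} \<longrightarrow>
        real R / real (?N + 1) - (\<epsilon> + 1 / (2 * real (?N + 1))) \<le>
          smoothed_cdf \<kappa> (cpd m n E sol (\<tau> w) (\<lambda>j. Z j w)) (cpd_atom m n E sol (\<lambda>j. Z j w)) ?N (h w) (?y w) \<and>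
        smoothed_cdf \<kappa> (cpd m n E sol (\<tau> w) (\<lambda>j. Z j w)) (cpd_atom m n E sol (\<lambda>j. Z j w)) ?N (h w) (?y w) \<le>
          real R / real (?N + 1) + (\<epsilon> + 3 / (2 * real (?N + 1)))"
      using inj fid sol \<tau>(2) inj_S
    proof eventually_elim
      case (elim w)
      define R where "R = card {i\<in>{1..?N}. S (m + i) w < S (n + 1) w}"
      let ?z = "training m (\<lambda>j. Z j w)" and ?x = "fst (Z (n + 1) w)"
      have mono_E: "mono (\<lambda>y. E ?z (?x, y))"
        using E by (simp add: conformity_measure_def training_def space_PiM)
      have S_test: "S (n + 1) w = E ?z (?x, ?y w)" by (simp add: S_def)
      have S_atom: "S (m + i) w = E ?z (?x, ?C w i)" if "i \<in> {1..?N}" for i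
        using elim(3) that unfolding solves_atom_equations_def S_def by blast
      \<comment> \<open>Monotonicity gives only two weak implications; distinct scores upgrade them
        to an equivalence of strict inequalities.\<close>
      have "?C w i < ?y w \<longleftrightarrow> S (m + i) w < S (n + 1) w" if i: "i \<in> {1..?N}" for i
      proof -
        have "m + i \<le> n" using i by auto
        then have "S (m + i) w \<noteq> S (n + 1) w"
          using inj_onD[OF elim(5), of "m + i" "n + 1"] i by auto
        moreover have "?C w i \<le> ?y w \<Longrightarrow> S (m + i) w \<le> S (n + 1) w"
          "?y w \<le> ?C w i \<Longrightarrow> S (n + 1) w \<le> S (m + i) w"
          unfolding S_test S_atom[OF i] by (rule monoD[OF mono_E], assumption)+
        ultimately show ?thesis by linarith
      qed
      then have R_eq: "card {i\<in>{1..?N}. ?C w i < ?y w} = R"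
        unfolding R_def by (intro arg_cong[where f = card]) auto
      have R_le: "R \<le> ?N"
        unfolding R_def by (rule order.trans[OF card_mono[of "{1..?N}"]]) auto
      have c: "strict_mono_on {1..?N} (order_stat ?N (?C w))"
        by (rule order_stat_strict_mono) (rule elim(1))
      have less: "order_stat ?N (?C w) i < ?y w \<longleftrightarrow> i \<le> R" if "i \<in> {1..?N}" for i
        using order_stat_less_iff[OF that, of "?C w" "?y w"] unfolding R_eq .
      show ?case
        using smoothed_tail_cpd_bounds[OF \<kappa> _ c _ _ _ _ less_imp_le[OF \<epsilon>] R_le less] elim(2,4) N
        by (simp add: cpd_def cpd_atom_def R_def)
    qed
    \<comment> \<open>Both deviations coincide here: the rounding loss \<open>1 / D\<close> added to
      the offset \<open>1 / (2 * D)\<close> is exactly the upper offset.\<close>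
    have "1 / (2 * D) + 1 / D = 3 / (2 * D)" for D :: real
      by (cases "D = 0") (simp_all add: field_simps)
    then show "\<epsilon> + 1 / (2 * real (?N + 1)) + 1 / real (?N + 1) \<le> \<epsilon> + 3 / (2 * real (?N + 1))"
      by (simp only: add.assoc order_refl)
  qed (use \<epsilon> in auto)
qed

theorem corollary3:
  fixes M :: "'w measure" and Z :: "nat \<Rightarrow> 'w \<Rightarrow> (real ^ 'p::finite) \<times> real"
    and \<kappa> :: "real \<Rightarrow> real" and \<epsilon> :: real and m n :: nat
  assumes "prob_space M"
    and "m < n"
    and "exchangeable M {1..n + 1} Z"
    and "kernel \<kappa>"
    and "0 < \<epsilon>"
  shows
    "(\<forall>E sol \<tau> h.
        conformity_measure m E \<longrightarrow>
        (\<forall>i\<in>{1..n - m}. (\<lambda>w. conformal_atom m n E sol (\<lambda>j. Z j w) i) \<in> borel_measurable M) \<longrightarrow>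
        (AE w in M. solves_atom_equations m n E sol (\<lambda>j. Z j w)) \<longrightarrow>
        (AE w in M. inj_on (conformal_atom m n E sol (\<lambda>j. Z j w)) {1..n - m}) \<longrightarrow>
        \<tau> \<in> borel_measurable M \<longrightarrow>
        distr M borel \<tau> = uniform_measure lborel {0..1} \<longrightarrow>
        independent_rv M borel \<tau>
          (\<Pi>\<^sub>M i\<in>{1..n + 1}. borel) (\<lambda>w. \<lambda>i\<in>{1..n + 1}. Z i w) \<longrightarrow>
        h \<in> borel_measurable M \<longrightarrow>
        (AE w in M. 0 < h w \<and>
           fidelity \<kappa> (cpd m n E sol (\<tau> w) (\<lambda>j. Z j w)) (cpd_atom m n E sol (\<lambda>j. Z j w))
             (n - m) (h w) \<epsilon>) \<longrightarrow>
        (AE w' in M.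
           (SUP u\<in>{0..1}. \<bar>\<P>(w in M. smoothed_cdf \<kappa> (cpd m n E sol (\<tau> w) (\<lambda>j. Z j w))
                (cpd_atom m n E sol (\<lambda>j. Z j w)) (n - m) (h w) (snd (Z (n + 1) w)) \<le> u) - u\<bar>)
           \<le> \<epsilon> + (MAX i\<in>{1..n - m}. 1 / 2 * jump_mass (cpd m n E sol (\<tau> w') (\<lambda>j. Z j w'))
                    (cpd_atom m n E sol (\<lambda>j. Z j w')) i)
               + 1 / real (n - m + 1)))
     \<and>
     (\<forall>f K h.
        (\<lambda>(z, x). f z x) \<in> borel_measurable ((\<Pi>\<^sub>M i\<in>{1..m}. borel) \<Otimes>\<^sub>M borel) \<longrightarrow>
        (AE w in M. inj_on (residual m f (\<lambda>j. Z j w)) {m + 1..n + 1}) \<longrightarrow>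
        0 < K \<longrightarrow> K < n - m + 1 \<longrightarrow>
        h \<in> borel_measurable M \<longrightarrow>
        (AE w in M. 0 < h w \<and>
           fidelity \<kappa> (qm m n K f (\<lambda>j. Z j w)) (qm_atom m n K f (\<lambda>j. Z j w)) K (h w) \<epsilon>) \<longrightarrow>
        (SUP u\<in>{0..1}. \<bar>\<P>(w in M. smoothed_cdf \<kappa> (qm m n K f (\<lambda>j. Z j w))
             (qm_atom m n K f (\<lambda>j. Z j w)) K (h w) (snd (Z (n + 1) w)) \<le> u) - u\<bar>)
        \<le> \<epsilon> + 3 / (2 * real K) + 1 / real (n - m + 1))"
proof (intro conjI allI impI, goal_cases)
  case (1 E sol \<tau> h)
  interpret prob_space M by fact
  let ?N = "n - m"
  let ?c = "\<lambda>w. cpd_atom m n E sol (\<lambda>j. Z j w)"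
  let ?Q = "\<lambda>w. cpd m n E sol (\<tau> w) (\<lambda>j. Z j w)"
  let ?P = "\<lambda>u. prob {w \<in> space M. smoothed_cdf \<kappa> (?Q w) (?c w) ?N (h w) (snd (Z (n + 1) w)) \<le> u}"
  have \<tau>: "AE w in M. 0 \<le> \<tau> w \<and> \<tau> w \<le> 1"
    using 1 by (intro AE_unit_interval_of_uniform) auto
  show ?case
    using 1(4) \<tau>
  proof eventually_elim
    case (elim w')
    have jump: "jump_mass (?Q w') (?c w') i = tail_mass ?N (\<tau> w') i" if "i \<in> {1..?N}" for i
      unfolding cpd_def cpd_atom_def
      using that elim(1) by (intro jump_mass_tail_cpd order_stat_strict_mono)
    \<comment> \<open>The first atom alone is a sufficient lower bound for the maximum: for
      \<open>\<tau> w'\<close> in the unit interval its mass is at least \<open>1 / (N + 1)\<close>,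
      and it is 1 if \<open>N = 1\<close>.\<close>
    have max: "tail_mass ?N (\<tau> w') 1 / 2 \<le> (MAX i\<in>{1..?N}. 1 / 2 * jump_mass (?Q w') (?c w') i)"
      using jump[of 1] \<open>m < n\<close> by (intro Max_ge) (auto simp: image_iff intro!: bexI[of _ 1])
    show ?case
    proof (cases "2 \<le> ?N")
      case True
      have "(SUP u\<in>{0..1}. \<bar>?P u - u\<bar>) \<le> \<epsilon> + 3 / (2 * real (?N + 1))"
        using 1 by (intro cpd_validity assms \<tau> True) auto
      also have "3 / (2 * D) = 1 / (2 * D) + 1 / D" for D :: real
        by (cases "D = 0") (simp_all add: field_simps)
      also have "1 / (2 * real (?N + 1)) \<le> tail_mass ?N (\<tau> w') 1 / 2"
        using elim(2) by (simp add: tail_mass_def field_simps)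
      also note max
      finally show ?thesis by (simp only: add.assoc)
    next
      case False
      \<comment> \<open>The two tail corrections add up on the only atom, so \<open>\<tau>\<close>
        cancels and the right-hand side is at least \<open>\<epsilon> + 1/2 + 1/2\<close>.\<close>
      then have N: "?N = 1" using \<open>m < n\<close> by simp
      have "(SUP u\<in>{0..1}. \<bar>?P u - u\<bar>) \<le> 1"
      proof (rule cSUP_least)
        fix u :: real assume "u \<in> {0..1}"
        moreover have "0 \<le> ?P u" "?P u \<le> 1" by auto
        ultimately show "\<bar>?P u - u\<bar> \<le> 1" by (simp only: atLeastAtMost_iff) linarith
      qed simp
      moreover have "tail_mass ?N (\<tau> w') 1 / 2 = 1 / 2" "1 / real (?N + 1) = 1 / 2"
        unfolding N by (simp_all add: tail_mass_def)
      ultimately show ?thesis using max \<open>0 < \<epsilon>\<close> by linarith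
    qed
  qed
next
  case (2 f K h)
  then show ?case by (intro qm_validity assms) auto
qed

end
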